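(* There exists a unique triplet $(R^{*},c^{*},\theta^{*})$ with $R^*>0$, $c^*>0$, $\theta^{*}\in C^1(\mathbb{R})$ that verifies the free interface system (P) described in the context (with $R=R^*$, $c=c^*$, $\theta=\theta^*$). Moreover, $\theta^{*}$ is increasing on $\mathbb{R}$ and there exists $K_0>0$ such that, with $$\lambda_-=\frac{c^*-\sqrt{(c^* )^2-4F'(\theta_+)}}{2}<0,$$ one has $$\theta_+-\theta^{*}(x)\leqslant K_0e^{\lambda_- x}\quad\text{as } x\to+\infty$$ (i.e. for all sufficiently large $x$).
   Context: Let $q,h,\theta_{ig},\theta_{hl}$ be positive real parameters, set $\theta_+=\left(1+\frac{q}{h}\right)^{1/4}-1$, and assume $0<\theta_{ig}<\theta_{hl}<\theta_+$. Let $F(\theta)=q-h\big((1+\theta)^4-1\big)$. The free interface system (P), for the unknown triplet $(R,c,\theta)$ with $R>0$, $c>0$ and $\theta:\mathbb{R}\to\mathbb{R}$, consists of the following requirements: 1. $\theta_{xx}-c\theta_x=0$ and $0<\theta<\theta_{ig}$ for $x\in(-\infty,0)$, with $\theta(x)\to0$ as $x\to-\infty$; 2. $\theta_{xx}-c\theta_x+q=0$ and $\theta_{ig}<\theta<\theta_{hl}$ for $x\in(0,R)$; 3. $\theta_{xx}-c\theta_x+F(\theta)=0$ and $\theta_{hl}<\theta<\theta_+$ for $x\in(R,+\infty)$, with $\theta(x)\to\theta_+$ as $x\to+\infty$; 4. $\theta(0)=\theta_{ig}$ and $\theta(R)=\theta_{hl}$; 5. $\theta_x$ has no jump at $x=0$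 and at $x=R$. The equations are understood in the classical sense on the open intervals. *)

theory Defs
  imports "HOL-Analysis.Analysis"
begin

definition theta_plus :: "real \<Rightarrow> real \<Rightarrow> real" where
  "theta_plus q h = (1 + q / h) powr (1 / 4) - 1"

definition F :: "real \<Rightarrow> real \<Rightarrow> real \<Rightarrow> real" where
  "F q h t = q - h * ((1 + t) ^ 4 - 1)"

(* Intended for open I, where "deriv" at x only depends on theta near x.  Continuity of the
   second derivative is not required separately: the equation expresses it through theta
   and its (differentiable) derivative, so for continuous g it is automatic. *)
definition classical_solution_on ::
  "real set \<Rightarrow> real \<Rightarrow> (real \<Rightarrow> real) \<Rightarrow> (real \<Rightarrow> real) \<Rightarrow> bool" where
  "classical_solution_on I c g \<theta> \<longleftrightarrow>
     (\<forall>x\<in>I. \<theta> differentiable (at x) \<and> deriv \<theta> differentiable (at x) \<and>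
        deriv (deriv \<theta>) x - c * deriv \<theta> x + g (\<theta> x) = 0)"

(* Both one-sided limits exist (as real numbers) and coincide. *)
definition no_jump_at :: "(real \<Rightarrow> real) \<Rightarrow> real \<Rightarrow> bool" where
  "no_jump_at f a \<longleftrightarrow> (\<exists>L. (f \<longlongrightarrow> L) (at_left a) \<and> (f \<longlongrightarrow> L) (at_right a))"

definition free_interface_system ::
  "real \<Rightarrow> real \<Rightarrow> real \<Rightarrow> real \<Rightarrow> real \<Rightarrow> real \<Rightarrow> (real \<Rightarrow> real) \<Rightarrow> bool" where
  "free_interface_system q h \<theta>ig \<theta>hl R c \<theta> \<longleftrightarrow>
     R > 0 \<and> c > 0 \<and>
     classical_solution_on {..<0} c (\<lambda>_. 0) \<theta> \<and>
     (\<forall>x\<in>{..<0}. 0 < \<theta> x \<and> \<theta> x < \<theta>ig) \<and>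
     (\<theta> \<longlongrightarrow> 0) at_bot \<and>
     classical_solution_on {0<..<R} c (\<lambda>_. q) \<theta> \<and>
     (\<forall>x\<in>{0<..<R}. \<theta>ig < \<theta> x \<and> \<theta> x < \<theta>hl) \<and>
     classical_solution_on {R<..} c (F q h) \<theta> \<and>
     (\<forall>x\<in>{R<..}. \<theta>hl < \<theta> x \<and> \<theta> x < theta_plus q h) \<and>
     (\<theta> \<longlongrightarrow> theta_plus q h) at_top \<and>
     \<theta> 0 = \<theta>ig \<and> \<theta> R = \<theta>hl \<and>
     no_jump_at (deriv \<theta>) 0 \<and> no_jump_at (deriv \<theta>) R"

definition lambda_minus :: "real \<Rightarrow> real \<Rightarrow> real \<Rightarrow> real" where
  "lambda_minus q h c = (c - sqrt (c\<^sup>2 - 4 * deriv (F q h) (theta_plus q h))) / 2"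

end

theory Submission
  imports Defs
begin

text \<open>
  Call \<open>x = R\<close> the front.  To its right, measured from it, the deficit
  \<open>w = \<theta>\<^sub>+ - \<theta>\<close> satisfies \<open>w'' - c w' = G(w)\<close>, where \<open>G(w) = F(\<theta>\<^sub>+ - w)\<close> vanishes at \<open>0\<close>
  and has slope between two positive constants on the relevant range.  This monotonicity
  is what makes the problem tractable without phase-plane or stable-manifold theory: the
  operator \<open>d \<mapsto> d'' - c d' - m d\<close> obeys a maximum principle on the half-line for functions that
  are only bounded above (\<open>half_line_maximum_principle\<close>), and the
  estimates on \<open>w\<close> are comparisons with explicit barriers.  Adding and subtracting \<open>M w\<close> turns the
  equation into a fixed-point problem, which is a contraction in the sup norm because the
  same principle bounds the inverse of \<open>- d'' + c d' + M d\<close>, with value \<open>0\<close> at the front, by \<open>1 / M\<close>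
  (\<open>ex_bounded_solution\<close>).  So each speed \<open>c \<ge> 0\<close> determines exactly one bounded \<open>w\<close> with
  prescribed value at the front, hence a slope \<open>P(c) = - w'(0) > 0\<close>, which is nonincreasing and
  Lipschitz in \<open>c\<close>.

  In the other two zones the equation integrates once.  For \<open>x \<le> 0\<close> the limit at
  \<open>-\<infinity>\<close> forces \<open>\<theta>' = c \<theta>\<close>, and in \<open>[0, R]\<close> the first integral \<open>\<theta>' = c \<theta> - q x\<close> follows, with the
  constant fixed by the continuity of \<open>\<theta>'\<close> at \<open>0\<close>.  Matching at \<open>R\<close> therefore means
  \<open>R = (c \<theta>\<^sub>h\<^sub>l - P(c)) / q\<close> together with one scalar equation in \<open>c\<close>.

  Existence is the intermediate value theorem for that scalar equation
  (\<open>ex_matching_speed\<close>), followed by gluing the three pieces.  For uniqueness, suppose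
  \<open>c\<^sub>1 < c\<^sub>2\<close>.  Monotonicity of \<open>P\<close> and the first integral give \<open>R\<^sub>1 < R\<^sub>2\<close>.  But the solution of
  \<open>\<phi>' = c \<phi> - q x\<close>, \<open>\<phi>(0) = \<theta>\<^sub>i\<^sub>g\<close>, increases with \<open>c\<close>, so the second profile has already
  exceeded \<open>\<theta>\<^sub>h\<^sub>l\<close> at \<open>R\<^sub>1\<close>, before its own front: a contradiction
  (\<open>system_speed_le\<close>).  Equal speeds give equal profiles in each zone.  The exponential
  rate comes from a supersolution \<open>Z - r Z\<^sup>2\<close>, \<open>Z\<close> a multiple of \<open>exp (\<lambda>\<^sub>- x)\<close>, whose quadratic
  correction absorbs the concavity of \<open>G\<close> (\<open>bounded_solution_exp_decay\<close>).
\<close>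

section \<open>A maximum principle on the half-line\<close>

lemma second_derivative_nonpos_at_maximum:
  fixes g g1 :: "real \<Rightarrow> real"
  assumes "a < z" "z < b"
    and max: "\<And>y. a < y \<Longrightarrow> y < b \<Longrightarrow> g y \<le> g z"
    and g1: "\<And>y. a < y \<Longrightarrow> y < b \<Longrightarrow> (g has_real_derivative g1 y) (at y)"
    and g2: "(g1 has_real_derivative D) (at z)"
  shows "g1 z = 0" and "D \<le> 0"
proof -
  define r where "r = min (z - a) (b - z)"
  have r: "r > 0" using assms(1,2) by (simp add: r_def)
  have "\<forall>y. \<bar>z - y\<bar> < r \<longrightarrow> g y \<le> g z"
    unfolding r_def using max by (auto simp: abs_if split: if_splits)
  then show zero: "g1 z = 0"
    using DERIV_local_max[OF g1[OF assms(1,2)] r] by blast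
  show "D \<le> 0"
  proof (rule ccontr)
    assume "\<not> D \<le> 0"
    then obtain e where e: "e > 0" "\<And>k. 0 < k \<Longrightarrow> k < e \<Longrightarrow> g1 z < g1 (z + k)"
      using DERIV_pos_inc_right[OF g2] by auto
    define y where "y = z + min e (b - z) / 2"
    have y: "z < y" "y < b" "y < z + e" using e(1) assms(2) by (auto simp: y_def min_def field_simps)
    obtain \<xi> where \<xi>: "z < \<xi>" "\<xi> < y" "g y - g z = (y - z) * g1 \<xi>"
      using MVT2[OF y(1), of g g1] g1 y assms(1) by fastforce
    have "g1 \<xi> > 0" using e(2)[of "\<xi> - z"] \<xi> y zero by simp
    then have "(y - z) * g1 \<xi> > 0" using y(1) by simp
    then have "g y > g z" using \<xi>(3) by linarith
    then show False using max[of y] y assms(1) by simp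
  qed
qed

text \<open>
  Boundedness from above replaces any condition at infinity: subtracting a small multiple
  of \<open>exp (sqrt m * x)\<close>, which is itself a supersolution because \<open>(sqrt m)\<^sup>2 - c * sqrt m \<le> m\<close>, moves a
  positive supremum to an interior maximum, where the differential inequality fails.
\<close>

lemma half_line_maximum_principle:
  fixes d d1 d2 :: "real \<Rightarrow> real"
  assumes c: "0 \<le> c" and m: "0 < m"
    and cont: "continuous_on {0..} d"
    and d1: "\<And>x. 0 < x \<Longrightarrow> (d has_real_derivative d1 x) (at x)"
    and d2: "\<And>x. 0 < x \<Longrightarrow> (d1 has_real_derivative d2 x) (at x)"
    and start: "d 0 \<le> 0"
    and bdd: "\<And>x. 0 \<le> x \<Longrightarrow> d x \<le> B"
    and sub: "\<And>x. 0 < x \<Longrightarrow> 0 < d x \<Longrightarrow> m * d x \<le> d2 x - c * d1 x"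
    and x: "0 \<le> x"
  shows "d x \<le> 0"
proof (rule ccontr)
  assume "\<not> d x \<le> 0"
  then have dx: "d x > 0" by simp
  define t where "t = sqrt m"
  have t: "t > 0" "t * t = m" using m by (auto simp: t_def)
  define e where "e = d x / (2 * exp (t * x))"
  have e: "e > 0" using dx by (simp add: e_def)
  define g where "g = (\<lambda>y. d y - e * exp (t * y))"
  have gx: "g x > 0" using dx by (simp add: g_def e_def)
  have B: "B > 0" using bdd[OF x] dx by simp
  \<comment> \<open>\<open>X\<close> is so large that the exponential exceeds the bound \<open>B\<close> on \<open>d\<close>.\<close>
  define X where "X = x + B / (e * t)"
  have X: "X > x" using B e t by (simp add: X_def)
  have "B \<le> e * exp (t * X)"
  proof -
    have "B \<le> e * (t * X)" using e t x by (simp add: X_def algebra_simps)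
    also have "\<dots> \<le> e * exp (t * X)"
      using exp_ge_add_one_self[of "t * X"] e by (intro mult_left_mono) linarith+
    finally show ?thesis .
  qed
  then have gX: "g X \<le> 0" using bdd[of X] X x by (simp add: g_def)
  have "continuous_on {0..X} g" unfolding g_def
    by (intro continuous_intros continuous_on_subset[OF cont]) auto
  then obtain z where z: "z \<in> {0..X}" "\<And>y. y \<in> {0..X} \<Longrightarrow> g y \<le> g z"
    using continuous_attains_sup[of "{0..X}" g] X x by auto
  have gz: "g z > 0" using z(2)[of x] gx X x by auto
  have "g 0 \<le> 0" using start e by (simp add: g_def)
  then have z': "0 < z" "z < X" using gz gX z(1) by (auto simp: less_le)
  have gd: "(g has_real_derivative d1 y - e * t * exp (t * y)) (at y)" if "0 < y" for y
    unfolding g_def by (rule derivative_eq_intros d1 that refl | simp)+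
  have gdd: "((\<lambda>y. d1 y - e * t * exp (t * y)) has_real_derivative d2 z - e * t * t * exp (t * z)) (at z)"
    by (rule derivative_eq_intros d2 z'(1) refl | simp)+
  have *: "d1 z = e * t * exp (t * z)" "d2 z \<le> e * t * t * exp (t * z)"
    using second_derivative_nonpos_at_maximum[OF z' _ gd gdd] z(2) by auto
  have dz: "d z > e * exp (t * z)" using gz by (simp add: g_def)
  then have "d z > 0" using e by (smt (verit) mult_pos_pos exp_gt_zero)
  then have "m * d z \<le> d2 z - c * d1 z" using sub z' by simp
  also have "\<dots> \<le> d2 z" using c t e by (simp add: *(1))
  also have "\<dots> \<le> m * (e * exp (t * z))" using *(2) t(2) by (simp add: algebra_simps)
  also have "\<dots> < m * d z" using dz m by simp
  finally show False by simp
qed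

lemma right_derivative_nonpos:
  fixes f :: "real \<Rightarrow> real"
  assumes D: "(f has_real_derivative D) (at 0 within {0..})"
    and "f 0 = 0" and "\<And>x. 0 \<le> x \<Longrightarrow> f x \<le> 0"
  shows "D \<le> 0"
proof (rule tendsto_upperbound)
  show "((\<lambda>y. (f y - f 0) / (y - 0)) \<longlongrightarrow> D) (at 0 within {0..})"
    using D by (simp add: has_field_derivative_iff)
  show "\<forall>\<^sub>F y in at 0 within {0..}. (f y - f 0) / (y - 0) \<le> 0"
    using assms(2,3) by (auto simp: eventually_at_filter divide_nonpos_nonneg)
  show "at (0::real) within {0..} \<noteq> bot"
    by (simp add: at_within_Ici_at_right)
qed

section \<open>First-order linear equations with bounded data\<close>

lemma exp_mult_cancel: "exp (k * x) * (exp (- k * x) * y) = (y :: real)"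
  by (simp add: exp_minus field_simps)

text \<open>
  The bounded solution is \<open>v x = exp (k * x) * (L - A x)\<close>, where \<open>A\<close> is an antiderivative of
  \<open>exp (- k * x) * f x\<close> and \<open>L\<close> its limit at \<open>+\<infinity>\<close>.  Instead of an improper integral, \<open>L\<close> is
  caught between an increasing and a decreasing function that differ by \<open>2 * B / k * exp (- k * x)\<close>;
  this enclosure is at the same time the bound on \<open>v\<close>.
\<close>

lemma bounded_solution_backward_linear_ode:
  fixes f :: "real \<Rightarrow> real"
  assumes f: "continuous_on UNIV f" "\<And>x. \<bar>f x\<bar> \<le> B" and k: "0 < k"
  shows "\<exists>v. (\<forall>x. (v has_real_derivative k * v x - f x) (at x)) \<and> (\<forall>x. \<bar>v x\<bar> \<le> B / k)"
proof -
  have "\<And>x. -\<infinity> < ereal x \<Longrightarrow> ereal x < \<infinity> \<Longrightarrow> isCont (\<lambda>x. exp (- k * x) * f x) x"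
    using f(1) by (auto intro!: continuous_intros simp: continuous_on_eq_continuous_at)
  then obtain A where A: "\<And>x. (A has_real_derivative exp (- k * x) * f x) (at x)"
    using einterval_antiderivative[of "-\<infinity>" "\<infinity>" "\<lambda>x. exp (- k * x) * f x"]
    by (auto simp: has_real_derivative_iff_has_vector_derivative)
  define lo hi where "lo = (\<lambda>x. A x - B / k * exp (- k * x))" and "hi = (\<lambda>x. A x + B / k * exp (- k * x))"
  have lo: "lo x \<le> lo y" if "x \<le> y" for x y
  proof (rule DERIV_nonneg_imp_nondecreasing[OF that])
    fix t
    have "(lo has_real_derivative exp (- k * t) * f t + B * exp (- k * t)) (at t)"
      unfolding lo_def by (rule derivative_eq_intros A refl | use k in simp)+
    moreover have "exp (- k * t) * f t + B * exp (- k * t) = exp (- k * t) * (f t + B)" by (simp add: algebra_simps)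
    moreover have "\<dots> \<ge> 0" using f(2)[of t] by (auto simp: abs_le_iff)
    ultimately show "\<exists>D. (lo has_real_derivative D) (at t) \<and> 0 \<le> D" by metis
  qed
  have hi: "hi y \<le> hi x" if "x \<le> y" for x y
  proof (rule DERIV_nonpos_imp_nonincreasing[OF that])
    fix t
    have "(hi has_real_derivative exp (- k * t) * f t - B * exp (- k * t)) (at t)"
      unfolding hi_def by (rule derivative_eq_intros A refl | use k in simp)+
    moreover have "exp (- k * t) * f t - B * exp (- k * t) = exp (- k * t) * (f t - B)" by (simp add: algebra_simps)
    moreover have "\<dots> \<le> 0" using f(2)[of t] by (auto simp: abs_le_iff mult_le_0_iff)
    ultimately show "\<exists>D. (hi has_real_derivative D) (at t) \<and> D \<le> 0" by metis
  qed
  have B: "B \<ge> 0" using f(2)[of 0] by simp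
  have lohi: "lo x \<le> hi y" for x y
  proof -
    have "lo x \<le> lo (max x y)" by (intro lo) simp
    also have "\<dots> \<le> hi (max x y)" using B k by (simp add: lo_def hi_def)
    also have "\<dots> \<le> hi y" by (intro hi) simp
    finally show ?thesis .
  qed
  define L where "L = (SUP x. lo x)"
  have L: "lo x \<le> L" "L \<le> hi x" for x
    unfolding L_def using lohi by (auto intro!: cSUP_upper cSUP_least bdd_aboveI2[where M = "hi 0"])
  define v where "v = (\<lambda>x. exp (k * x) * (L - A x))"
  have "(v has_real_derivative k * v x - f x) (at x)" for x
  proof -
    have "(v has_real_derivative k * exp (k * x) * (L - A x) - exp (k * x) * (exp (- k * x) * f x)) (at x)"
      unfolding v_def by (rule derivative_eq_intros A refl | simp)+
    then show ?thesis by (simp only: v_def exp_mult_cancel mult.assoc)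
  qed
  moreover have "\<bar>v x\<bar> \<le> B / k" for x
  proof -
    have "\<bar>L - A x\<bar> \<le> B / k * exp (- k * x)" using L[of x] by (auto simp: lo_def hi_def abs_le_iff)
    then have "exp (k * x) * \<bar>L - A x\<bar> \<le> exp (k * x) * (B / k * exp (- k * x))"
      by (intro mult_left_mono) auto
    also have "\<dots> = B / k" by (simp add: exp_minus)
    finally show ?thesis by (simp add: v_def abs_mult)
  qed
  ultimately show ?thesis by blast
qed

text \<open>
  Together with the backward equation this solves \<open>u'' - c * u' - M * u = - f\<close> with bounded \<open>u\<close>, by
  factoring the operator as \<open>(d/dx - \<mu>) (d/dx + \<nu>)\<close> with \<open>\<mu> - \<nu> = c\<close> and \<open>\<mu> * \<nu> = M\<close>.
\<close>

lemma solution_forward_linear_ode: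
  fixes v :: "real \<Rightarrow> real"
  assumes v: "continuous_on UNIV v" "\<And>x. \<bar>v x\<bar> \<le> B" and k: "0 < k"
  shows "\<exists>u. u 0 = a \<and> (\<forall>x. (u has_real_derivative v x - k * u x) (at x)) \<and>
           (\<forall>x\<ge>0. \<bar>u x\<bar> \<le> \<bar>a\<bar> + B / k)"
proof -
  have "\<And>x. -\<infinity> < ereal x \<Longrightarrow> ereal x < \<infinity> \<Longrightarrow> isCont (\<lambda>x. exp (k * x) * v x) x"
    using v(1) by (auto intro!: continuous_intros simp: continuous_on_eq_continuous_at)
  then obtain A where A: "\<And>x. (A has_real_derivative exp (k * x) * v x) (at x)"
    using einterval_antiderivative[of "-\<infinity>" "\<infinity>" "\<lambda>x. exp (k * x) * v x"]
    by (auto simp: has_real_derivative_iff_has_vector_derivative)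
  have B: "B \<ge> 0" using v(2)[of 0] by simp
  define u where "u = (\<lambda>x. exp (- k * x) * (a + A x - A 0))"
  have "(u has_real_derivative v x - k * u x) (at x)" for x
  proof -
    have "(u has_real_derivative exp (- k * x) * (exp (k * x) * v x) - k * exp (- k * x) * (a + A x - A 0)) (at x)"
      unfolding u_def by (rule derivative_eq_intros A refl | simp)+
    then show ?thesis
      using exp_mult_cancel[of "- k" x "v x"] by (simp only: u_def mult.assoc minus_minus)
  qed
  moreover have "\<bar>u x\<bar> \<le> \<bar>a\<bar> + B / k" if x: "x \<ge> 0" for x
  proof -
    have 1: "A x - B / k * exp (k * x) \<le> A 0 - B / k * exp (k * 0)"
    proof (rule DERIV_nonpos_imp_nonincreasing[OF x])
      fix t
      have "((\<lambda>x. A x - B / k * exp (k * x)) has_real_derivative exp (k * t) * v t - B * exp (k * t)) (at t)"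
        by (rule derivative_eq_intros A refl | use k in simp)+
      moreover have "exp (k * t) * v t - B * exp (k * t) = exp (k * t) * (v t - B)" by (simp add: algebra_simps)
      moreover have "\<dots> \<le> 0" using v(2)[of t] by (auto simp: abs_le_iff mult_le_0_iff)
      ultimately show "\<exists>D. ((\<lambda>x. A x - B / k * exp (k * x)) has_real_derivative D) (at t) \<and> D \<le> 0" by metis
    qed
    have 2: "A 0 + B / k * exp (k * 0) \<le> A x + B / k * exp (k * x)"
    proof (rule DERIV_nonneg_imp_nondecreasing[OF x])
      fix t
      have "((\<lambda>x. A x + B / k * exp (k * x)) has_real_derivative exp (k * t) * v t + B * exp (k * t)) (at t)"
        by (rule derivative_eq_intros A refl | use k in simp)+
      moreover have "exp (k * t) * v t + B * exp (k * t) = exp (k * t) * (v t + B)" by (simp add: algebra_simps)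
      moreover have "\<dots> \<ge> 0" using v(2)[of t] by (auto simp: abs_le_iff)
      ultimately show "\<exists>D. ((\<lambda>x. A x + B / k * exp (k * x)) has_real_derivative D) (at t) \<and> 0 \<le> D" by metis
    qed
    have "0 \<le> B / k" using B k by simp
    then have "\<bar>A x - A 0\<bar> \<le> B / k * exp (k * x)"
      using 1 2 by (simp add: abs_le_iff)
    then have "\<bar>u x\<bar> \<le> exp (- k * x) * (\<bar>a\<bar> + B / k * exp (k * x))"
      unfolding u_def abs_mult by (intro mult_mono) auto
    also have "\<dots> = exp (- k * x) * \<bar>a\<bar> + B / k" by (simp add: algebra_simps exp_minus)
    also have "\<dots> \<le> 1 * \<bar>a\<bar> + B / k" using k x by (intro add_mono mult_right_mono) auto
    finally show ?thesis by simp
  qed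
  moreover have "u 0 = a" by (simp add: u_def)
  ultimately show ?thesis by blast
qed

section \<open>Bounded solutions for an increasing reaction\<close>

text \<open>
  The upper slope bound is written as a square because \<open>\<nu>\<close> itself is a decay rate: for
  \<open>c \<ge> 0\<close> no positive solution decays faster than \<open>exp (- \<nu> * x)\<close>.
\<close>

locale monotone_reaction =
  fixes G :: "real \<Rightarrow> real" and a m \<nu> :: real
  assumes a: "0 < a" and m: "0 < m" and \<nu>: "0 < \<nu>" and G0: "G 0 = 0"
    and incr: "\<And>y z. 0 \<le> y \<Longrightarrow> y \<le> z \<Longrightarrow> z \<le> a \<Longrightarrow> m * (z - y) \<le> G z - G y"
    and lip: "\<And>y z. 0 \<le> y \<Longrightarrow> y \<le> z \<Longrightarrow> z \<le> a \<Longrightarrow> G z - G y \<le> \<nu>\<^sup>2 * (z - y)"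
begin

text \<open>
  The derivative is an explicit argument because at the front \<open>x = 0\<close> it is one-sided, and its value
  there is the quantity to be matched.  No value at \<open>0\<close> is prescribed, so that the class is closed
  under translation to the left.
\<close>

definition bounded_solution :: "real \<Rightarrow> (real \<Rightarrow> real) \<Rightarrow> (real \<Rightarrow> real) \<Rightarrow> bool" where
  "bounded_solution c w w' \<longleftrightarrow>
     continuous_on {0..} w' \<and>
     (\<forall>x\<ge>0. (w has_real_derivative w' x) (at x within {0..})) \<and>
     (\<forall>x>0. (w' has_real_derivative c * w' x + G (w x)) (at x)) \<and>
     (\<forall>x\<ge>0. 0 \<le> w x \<and> w x \<le> a)"

lemma m_le: "m \<le> \<nu>\<^sup>2"
proof -
  have "m * (a - 0) \<le> \<nu>\<^sup>2 * (a - 0)" using incr[of 0 a] lip[of 0 a] a by linarith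
  then show ?thesis using a by simp
qed

lemma G_bounds:
  assumes "0 \<le> y" "y \<le> a"
  shows "m * y \<le> G y" and "G y \<le> \<nu>\<^sup>2 * y" and "0 \<le> G y"
proof -
  show *: "m * y \<le> G y" and "G y \<le> \<nu>\<^sup>2 * y"
    using incr[of 0 y] lip[of 0 y] assms G0 by simp_all
  show "0 \<le> G y" using * assms m by (meson mult_nonneg_nonneg less_imp_le order_trans)
qed

lemma bounded_solution_deriv:
  assumes "bounded_solution c w w'" "0 < x"
  shows "(w has_real_derivative w' x) (at x)"
proof -
  have "at x within {0..} = at x" using assms(2) by (intro at_within_interior) simp
  then show ?thesis using assms by (metis bounded_solution_def less_imp_le)
qed

lemma bounded_solution_cont:
  assumes "bounded_solution c w w'"
  shows "continuous_on {0..} w"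
  using assms unfolding bounded_solution_def
  by (auto intro!: DERIV_continuous_on[where D = w'])

lemma bounded_solutionD:
  assumes "bounded_solution c w w'"
  shows "continuous_on {0..} w'"
    and "\<And>x. 0 \<le> x \<Longrightarrow> (w has_real_derivative w' x) (at x within {0..})"
    and "\<And>x. 0 < x \<Longrightarrow> (w' has_real_derivative c * w' x + G (w x)) (at x)"
    and "\<And>x. 0 \<le> x \<Longrightarrow> 0 \<le> w x" and "\<And>x. 0 \<le> x \<Longrightarrow> w x \<le> a"
  using assms by (auto simp: bounded_solution_def)

section \<open>Existence by contraction\<close>

text \<open>
  With \<open>f(w) = M w - G(w)\<close> the equation reads \<open>w'' - c w' - M w = - f(w)\<close>.  By the maximum
  principle the linear problem depends on its right-hand side with Lipschitz constant
  \<open>1 / M\<close>, while \<open>f\<close> has Lipschitz constant \<open>M - m\<close>; so the iteration contracts by \<open>(M - m) / M\<close>.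
\<close>

lemma ex_bounded_solution:
  assumes c: "0 \<le> c"
  shows "\<exists>w w'. bounded_solution c w w' \<and> w 0 = a"
proof -
  define M where "M = \<nu> * (\<nu> + c)"
  have M: "\<nu>\<^sup>2 \<le> M" using \<nu> c by (simp add: M_def power2_eq_square algebra_simps)
  then have M: "\<nu>\<^sup>2 \<le> M" "0 < M" "m \<le> M" using m_le m by linarith+
  \<comment> \<open>Clamping to \<open>[0, a]\<close> makes the nonlinearity globally Lipschitz; the fixed point is
      shown afterwards to take its values in \<open>[0, a]\<close>.\<close>
  define cl where "cl = (\<lambda>y::real. max 0 (min a y))"
  define f where "f = (\<lambda>y. M * cl y - G (cl y))"
  have cl: "0 \<le> cl y" "cl y \<le> a" "y \<le> z \<Longrightarrow> cl y \<le> cl z" "y \<le> z \<Longrightarrow> cl z - cl y \<le> z - y" for y z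
    using a by (auto simp: cl_def)
  have f_step: "0 \<le> f z - f y \<and> f z - f y \<le> (M - m) * (z - y)" if "y \<le> z" for y z
  proof -
    have "m * (cl z - cl y) \<le> G (cl z) - G (cl y)" "G (cl z) - G (cl y) \<le> \<nu>\<^sup>2 * (cl z - cl y)"
      using cl that by (auto intro!: incr lip)
    moreover have "\<nu>\<^sup>2 * (cl z - cl y) \<le> M * (cl z - cl y)"
      using M cl(3)[OF that] by (intro mult_right_mono) auto
    moreover have "(M - m) * (cl z - cl y) \<le> (M - m) * (z - y)"
      using M cl(4)[OF that] by (intro mult_left_mono) auto
    ultimately show ?thesis by (simp add: f_def algebra_simps)
  qed
  have f_lip: "\<bar>f z - f y\<bar> \<le> (M - m) * \<bar>z - y\<bar>" for y z
    using f_step[of y z] f_step[of z y] by (cases "y \<le> z") (auto simp: abs_if)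
  have f_range: "0 \<le> f y" "f y \<le> M * a" for y
  proof -
    have "G (cl y) \<le> \<nu>\<^sup>2 * cl y" "0 \<le> G (cl y)" using cl by (auto intro!: G_bounds)
    moreover have "\<nu>\<^sup>2 * cl y \<le> M * cl y" "M * cl y \<le> M * a"
      using M cl by (auto intro!: mult_right_mono)
    ultimately show "0 \<le> f y" "f y \<le> M * a" by (auto simp: f_def)
  qed
  have f_cont: "continuous_on UNIV f"
    by (rule lipschitz_on_continuous_on[of "M - m"], rule lipschitz_onI)
       (use f_lip M in \<open>auto simp: dist_real_def\<close>)
  define solves where "solves g u u' \<longleftrightarrow> u 0 = a \<and> (\<forall>x. (u has_real_derivative u' x) (at x)) \<and>
      (\<forall>x. (u' has_real_derivative c * u' x + M * u x - f (g x)) (at x)) \<and>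
      (\<exists>B. \<forall>x\<ge>0. \<bar>u x\<bar> \<le> B)" for g u u'
  have solves_ex: "\<exists>u u'. solves g u u'" if g: "continuous_on UNIV g" for g
  proof -
    have "continuous_on UNIV (\<lambda>x. f (g x))"
      using continuous_on_compose2[OF f_cont g] by simp
    moreover have "\<And>x. \<bar>f (g x)\<bar> \<le> M * a" using f_range by simp
    ultimately obtain v where v: "\<And>x. (v has_real_derivative (\<nu> + c) * v x - f (g x)) (at x)"
      "\<And>x. \<bar>v x\<bar> \<le> M * a / (\<nu> + c)"
      using bounded_solution_backward_linear_ode[of "\<lambda>x. f (g x)" "M * a" "\<nu> + c"] \<nu> c by auto
    have v_cont: "continuous_on UNIV v" using v(1) DERIV_isCont continuous_at_imp_continuous_on by blast
    obtain u where u: "u 0 = a" "\<And>x. (u has_real_derivative v x - \<nu> * u x) (at x)"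
      "\<And>x. x \<ge> 0 \<Longrightarrow> \<bar>u x\<bar> \<le> \<bar>a\<bar> + (M * a / (\<nu> + c)) / \<nu>"
      using solution_forward_linear_ode[OF v_cont v(2) \<nu>, of a] by blast
    have "((\<lambda>x. v x - \<nu> * u x) has_real_derivative
        c * (v x - \<nu> * u x) + M * u x - f (g x)) (at x)" for x
      by (rule derivative_eq_intros v u refl)+ (simp add: M_def algebra_simps)
    then have "solves g u (\<lambda>x. v x - \<nu> * u x)" using u unfolding solves_def by blast
    then show ?thesis by blast
  qed
  have solves_le: "u1 x - u2 x \<le> K / M"
    if s: "solves g1 u1 u1'" "solves g2 u2 u2'"
      and K: "\<And>x. \<bar>f (g1 x) - f (g2 x)\<bar> \<le> K" and x: "0 \<le> x" for g1 u1 u1' g2 u2 u2' K x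
  proof -
    have K0: "0 \<le> K" using K[of 0] by simp
    obtain B1 B2 where B: "\<And>x. x \<ge> 0 \<Longrightarrow> \<bar>u1 x\<bar> \<le> B1" "\<And>x. x \<ge> 0 \<Longrightarrow> \<bar>u2 x\<bar> \<le> B2"
      using s by (auto simp: solves_def)
    have du: "(u1 has_real_derivative u1' x) (at x)" "(u2 has_real_derivative u2' x) (at x)"
      "(u1' has_real_derivative c * u1' x + M * u1 x - f (g1 x)) (at x)"
      "(u2' has_real_derivative c * u2' x + M * u2 x - f (g2 x)) (at x)" for x
      using s by (auto simp: solves_def)
    have "u1 x - u2 x - K / M \<le> 0"
    proof (rule half_line_maximum_principle[OF c M(2) _ _ _ _ _ _ x])
      show "((\<lambda>x. u1 x - u2 x - K / M) has_real_derivative u1' x - u2' x) (at x)" for x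
        by (rule derivative_eq_intros du refl)+ simp
      then show "continuous_on {0..} (\<lambda>x. u1 x - u2 x - K / M)"
        using DERIV_isCont continuous_at_imp_continuous_on by blast
      show "((\<lambda>x. u1' x - u2' x) has_real_derivative
          (c * u1' x + M * u1 x - f (g1 x)) - (c * u2' x + M * u2 x - f (g2 x))) (at x)" for x
        by (rule derivative_eq_intros du refl)+
      show "u1 0 - u2 0 - K / M \<le> 0" using s K0 M by (simp add: solves_def)
      show "u1 x - u2 x - K / M \<le> B1 + B2" if "0 \<le> x" for x
        using B[OF that] K0 M zero_le_divide_iff[of K M] by linarith
      show "M * (u1 x - u2 x - K / M) \<le>
          (c * u1' x + M * u1 x - f (g1 x)) - (c * u2' x + M * u2 x - f (g2 x)) - c * (u1' x - u2' x)" for x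
        using K[of x] M by (simp add: algebra_simps abs_le_iff)
    qed
    then show ?thesis by simp
  qed
  \<comment> \<open>Bounded continuous functions on the whole line serve as the Banach space; a function on
      the half-line enters it by constant extension to the left, hence \<open>max 0 x\<close>.\<close>
  have fixed: "\<exists>g :: real \<Rightarrow>\<^sub>C real. \<exists>u u'. solves g u u' \<and> (\<forall>x. g x = u (max 0 x))"
  proof -
    define rel where "rel g h \<longleftrightarrow> (\<exists>u u'. solves g u u' \<and> (\<forall>x. h x = u (max 0 x)))"
      for g h :: "real \<Rightarrow>\<^sub>C real"
    have rel_ex: "\<exists>h. rel g h" for g
    proof -
      obtain u u' where u: "solves g u u'"
        using solves_ex[OF continuous_on_apply_bcontfun] by blast
      obtain B where u': "\<And>x. (u has_real_derivative u' x) (at x)" and B: "\<And>x. x \<ge> 0 \<Longrightarrow> \<bar>u x\<bar> \<le> B"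
        using u by (auto simp: solves_def)
      have "continuous_on UNIV u"
        using u' DERIV_isCont continuous_at_imp_continuous_on by blast
      moreover have "continuous_on UNIV (\<lambda>x :: real. max 0 x)" by (intro continuous_intros)
      ultimately have "continuous_on UNIV (\<lambda>x. u (max 0 x))"
        by (rule continuous_on_compose2) simp
      moreover have "bounded (range (\<lambda>x. u (max 0 x)))"
        using B by (intro boundedI[of _ B]) auto
      ultimately have "(\<lambda>x. u (max 0 x)) \<in> bcontfun" by (simp add: bcontfun_def)
      then have "apply_bcontfun (Bcontfun (\<lambda>x. u (max 0 x))) = (\<lambda>x. u (max 0 x))"
        by (rule Bcontfun_inverse)
      then show ?thesis unfolding rel_def using u by metis
    qed
    define T where "T g = (SOME h. rel g h)" for g
    have T: "rel g (T g)" for g unfolding T_def by (rule someI_ex[OF rel_ex])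
    have "dist (T g1) (T g2) \<le> ((M - m) / M) * dist g1 g2" for g1 g2
    proof (rule dist_bound)
      fix x :: real
      obtain u1 u1' where 1: "solves g1 u1 u1'" "\<And>x. T g1 x = u1 (max 0 x)"
        using T[of g1] by (auto simp: rel_def)
      obtain u2 u2' where 2: "solves g2 u2 u2'" "\<And>x. T g2 x = u2 (max 0 x)"
        using T[of g2] by (auto simp: rel_def)
      have K: "\<bar>f (g1 x) - f (g2 x)\<bar> \<le> (M - m) * dist g1 g2" for x
      proof -
        have "\<bar>f (g1 x) - f (g2 x)\<bar> \<le> (M - m) * \<bar>g1 x - g2 x\<bar>" by (rule f_lip)
        also have "\<dots> \<le> (M - m) * dist g1 g2"
          using M dist_bounded[of g1 x g2] by (intro mult_left_mono) (auto simp: dist_real_def)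
        finally show ?thesis .
      qed
      have K': "\<bar>f (g2 x) - f (g1 x)\<bar> \<le> (M - m) * dist g1 g2" for x
        using K[of x] by (simp add: abs_minus_commute)
      show "dist (T g1 x) (T g2 x) \<le> ((M - m) / M) * dist g1 g2"
        using solves_le[OF 1(1) 2(1) K, of "max 0 x"] solves_le[OF 2(1) 1(1) K', of "max 0 x"]
        by (simp add: 1(2) 2(2) dist_real_def abs_le_iff)
    qed
    moreover have "0 \<le> (M - m) / M" "(M - m) / M < 1" using M m by auto
    ultimately obtain g where "T g = g"
      using banach_fix_type[of "(M - m) / M" T] by blast
    then show ?thesis using T[of g] by (auto simp: rel_def)
  qed
  then obtain g :: "real \<Rightarrow>\<^sub>C real" and u u' where u: "solves g u u'" "\<And>x. g x = u (max 0 x)"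
    by blast
  have du: "(u has_real_derivative u' x) (at x)"
      "(u' has_real_derivative c * u' x + M * u x - f (g x)) (at x)" for x
    using u(1) by (auto simp: solves_def)
  have u_cont: "continuous_on S u" "continuous_on S u'" for S
    by (auto intro!: continuous_at_imp_continuous_on DERIV_isCont[OF du(1)] DERIV_isCont[OF du(2)])
  obtain B where B: "\<And>x. x \<ge> 0 \<Longrightarrow> \<bar>u x\<bar> \<le> B" using u(1) by (auto simp: solves_def)
  have lower: "- u x \<le> 0" if x: "0 \<le> x" for x
  proof (rule half_line_maximum_principle[OF c M(2) _ _ _ _ _ _ x])
    show "continuous_on {0..} (\<lambda>x. - u x)" by (intro continuous_intros u_cont)
    show "((\<lambda>x. - u x) has_real_derivative - u' x) (at x)"
      "((\<lambda>x. - u' x) has_real_derivative - (c * u' x + M * u x - f (g x))) (at x)" for x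
      by (rule derivative_eq_intros du refl)+
    show "- u 0 \<le> 0" using u(1) a by (simp add: solves_def)
    show "- u x \<le> B" if "0 \<le> x" for x using B[OF that] by simp
    show "M * - u x \<le> - (c * u' x + M * u x - f (g x)) - c * - u' x" for x
      using f_range(1)[of "g x"] by simp
  qed
  have upper: "u x - a \<le> 0" if x: "0 \<le> x" for x
  proof (rule half_line_maximum_principle[OF c M(2) _ _ _ _ _ _ x])
    show "continuous_on {0..} (\<lambda>x. u x - a)" by (intro continuous_intros u_cont)
    show "((\<lambda>x. u x - a) has_real_derivative u' x) (at x)"
      "(u' has_real_derivative (c * u' x + M * u x - f (g x))) (at x)" for x
      by (rule derivative_eq_intros du refl | simp)+
    show "u 0 - a \<le> 0" using u(1) a by (simp add: solves_def)
    show "u x - a \<le> B" if "0 \<le> x" for x using B[OF that] a by simp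
    show "M * (u x - a) \<le> (c * u' x + M * u x - f (g x)) - c * u' x" for x
      using f_range(2)[of "g x"] by (simp add: algebra_simps)
  qed
  have "f (g x) = M * u x - G (u x)" if "0 \<le> x" for x
    using lower[OF that] upper[OF that] that by (simp add: u(2) f_def cl_def)
  then have eq: "c * u' x + M * u x - f (g x) = c * u' x + G (u x)" if "0 \<le> x" for x
    using that by simp
  have "(u' has_real_derivative c * u' x + G (u x)) (at x)" if "0 < x" for x
    using du(2)[of x] unfolding eq[OF less_imp_le[OF that]] .
  then have "bounded_solution c u u'"
    unfolding bounded_solution_def
    using has_field_derivative_at_within[OF du(1)] u_cont lower upper by auto
  moreover have "u 0 = a" using u(1) by (simp add: solves_def)
  ultimately show ?thesis by blast
qed

section \<open>Behaviour of bounded solutions\<close>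

lemma bounded_solution_shift:
  assumes w: "bounded_solution c w w'" and x0: "0 \<le> x0"
  shows "bounded_solution c (\<lambda>x. w (x0 + x)) (\<lambda>x. w' (x0 + x))"
  unfolding bounded_solution_def
proof (intro conjI allI impI)
  note D = bounded_solutionD[OF w]
  show "continuous_on {0..} (\<lambda>x. w' (x0 + x))"
    using x0 by (intro continuous_on_compose2[OF D(1)] continuous_intros) auto
  fix x :: real
  show "((\<lambda>x. w' (x0 + x)) has_real_derivative c * w' (x0 + x) + G (w (x0 + x))) (at x)" if "0 < x"
    using DERIV_at_within_shift[of w' "c * w' (x0 + x) + G (w (x0 + x))" x0 x UNIV] D(3)[of "x0 + x"] x0 that
    by simp
  assume x: "0 \<le> x"
  show "0 \<le> w (x0 + x)" "w (x0 + x) \<le> a" using D(4,5) x0 x by auto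
  have "(w has_real_derivative w' (x0 + x)) (at (x0 + x) within (+) x0 ` {0..})"
    by (rule has_field_derivative_subset[OF D(2)]) (use x x0 in auto)
  then show "((\<lambda>x. w (x0 + x)) has_real_derivative w' (x0 + x)) (at x within {0..})"
    by (rule DERIV_at_within_shift_lemma[unfolded o_def])
qed

text \<open>
  Since \<open>G(w) \<le> \<nu>\<^sup>2 * w\<close>, the exponential on the left is a subsolution for every speed \<open>c \<ge> 0\<close>.
\<close>

lemma bounded_solution_lower:
  assumes w: "bounded_solution c w w'" and c: "0 \<le> c" and x: "0 \<le> x"
  shows "w 0 * exp (- \<nu> * x) \<le> w x"
proof -
  note D = bounded_solutionD[OF w]
  have M: "0 < \<nu>\<^sup>2" using \<nu> by simp
  have "w 0 * exp (- \<nu> * x) - w x \<le> 0"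
  proof (rule half_line_maximum_principle[OF c M _ _ _ _ _ _ x])
    show "continuous_on {0..} (\<lambda>x. w 0 * exp (- \<nu> * x) - w x)"
      by (intro continuous_intros bounded_solution_cont[OF w])
    show "((\<lambda>x. w 0 * exp (- \<nu> * x) - w x) has_real_derivative
        - \<nu> * w 0 * exp (- \<nu> * x) - w' x) (at x)" if "0 < x" for x
      by (rule derivative_eq_intros bounded_solution_deriv[OF w that] refl | simp)+
    show "((\<lambda>x. - \<nu> * w 0 * exp (- \<nu> * x) - w' x) has_real_derivative
        \<nu>\<^sup>2 * w 0 * exp (- \<nu> * x) - (c * w' x + G (w x))) (at x)" if "0 < x" for x
      by (rule derivative_eq_intros D(3)[OF that] refl | simp add: power2_eq_square)+
    show "w 0 * exp (- \<nu> * 0) - w 0 \<le> 0" by simp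
    show "w 0 * exp (- \<nu> * x) - w x \<le> a" if "0 \<le> x" for x
    proof -
      have "w 0 * exp (- \<nu> * x) \<le> w 0 * 1" using D(4)[of 0] \<nu> that by (intro mult_left_mono) auto
      then show ?thesis using D(4)[OF that] D(5)[of 0] by simp
    qed
    show "\<nu>\<^sup>2 * (w 0 * exp (- \<nu> * x) - w x) \<le> \<nu>\<^sup>2 * w 0 * exp (- \<nu> * x) - (c * w' x + G (w x))
        - c * (- \<nu> * w 0 * exp (- \<nu> * x) - w' x)" if "0 < x" for x
    proof -
      have "G (w x) \<le> \<nu>\<^sup>2 * w x" using D(4,5)[of x] that by (intro G_bounds) auto
      moreover have "0 \<le> c * \<nu> * w 0 * exp (- \<nu> * x)" using c \<nu> D(4)[of 0] by simp
      ultimately show ?thesis by (simp add: algebra_simps)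
    qed
  qed
  then show ?thesis by simp
qed

lemma bounded_solution_pos:
  assumes "bounded_solution c w w'" "0 \<le> c" "0 < w 0" "0 \<le> x"
  shows "0 < w x"
  using bounded_solution_lower[OF assms(1,2,4)] assms(3)
  by (meson exp_gt_zero less_le_trans mult_pos_pos)

text \<open>
  The exponential lower bound, started at \<open>x\<close>, touches \<open>w\<close> there, so its slope is a lower bound
  for that of \<open>w\<close>.
\<close>

lemma bounded_solution_deriv_lower:
  assumes w: "bounded_solution c w w'" and c: "0 \<le> c" and x: "0 \<le> x"
  shows "- (\<nu> * w x) \<le> w' x"
proof -
  define z where "z = (\<lambda>y. w (x + y))"
  have z: "bounded_solution c z (\<lambda>y. w' (x + y))"
    unfolding z_def by (rule bounded_solution_shift[OF w x])
  have "- \<nu> * z 0 - w' (x + 0) \<le> 0"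
  proof (rule right_derivative_nonpos)
    show "((\<lambda>y. z 0 * exp (- \<nu> * y) - z y) has_real_derivative - \<nu> * z 0 - w' (x + 0)) (at 0 within {0..})"
      by (rule derivative_eq_intros bounded_solutionD(2)[OF z] refl | simp)+
    show "z 0 * exp (- \<nu> * y) - z y \<le> 0" if "0 \<le> y" for y
      using bounded_solution_lower[OF z c that] by simp
  qed simp
  then show ?thesis by (simp add: z_def)
qed

text \<open>
  \<open>exp (- c * x) * w' x\<close> has derivative \<open>exp (- c * x) * G (w x) > 0\<close>.  If \<open>w'\<close> were ever nonnegative
  it would thus eventually stay above a positive constant, and \<open>w\<close> would be unbounded.
\<close>

lemma bounded_solution_decreasing:
  assumes w: "bounded_solution c w w'" and c: "0 \<le> c"
    and pos: "\<And>x. 0 \<le> x \<Longrightarrow> 0 < w x" and x: "0 \<le> x"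
  shows "w' x < 0"
proof (rule ccontr)
  assume "\<not> w' x < 0"
  note D = bounded_solutionD[OF w]
  define p where "p = (\<lambda>x. exp (- c * x) * w' x)"
  have p_strict: "p s < p t" if "0 \<le> s" "s < t" for s t
  proof (rule DERIV_pos_imp_increasing_open[OF that(2)])
    show "continuous_on {s..t} p" unfolding p_def
      using that by (intro continuous_intros continuous_on_subset[OF D(1)]) auto
    fix y assume y: "s < y" "y < t"
    have "(p has_real_derivative exp (- c * y) * G (w y)) (at y)"
      unfolding p_def
      by (rule derivative_eq_intros D(3) refl | use y that in \<open>simp add: algebra_simps\<close>)+
    moreover have "0 < G (w y)"
      using G_bounds(1)[of "w y"] pos[of y] D(5)[of y] y that m
      by (smt (verit) mult_pos_pos)
    ultimately show "\<exists>D. (p has_real_derivative D) (at y) \<and> 0 < D" by auto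
  qed
  define x1 k where "x1 = x + 1" and "k = w' x1"
  have "0 < p x1" using p_strict[OF x, of x1] \<open>\<not> w' x < 0\<close>
    by (smt (verit) x1_def p_def exp_gt_zero mult_nonneg_nonneg)
  then have k: "0 < k" by (simp add: p_def k_def zero_less_mult_iff)
  have slope: "k \<le> w' y" if "x1 \<le> y" for y
  proof -
    have "p x1 \<le> p y" using p_strict[of x1 y] that x by (cases "x1 = y") (auto simp: x1_def)
    then have "exp (c * y) * (exp (- c * x1) * k) \<le> exp (c * y) * (exp (- c * y) * w' y)"
      unfolding p_def k_def by (intro mult_left_mono) auto
    then have "exp (c * (y - x1)) * k \<le> w' y"
      by (simp only: exp_mult_cancel) (simp add: algebra_simps exp_diff exp_minus divide_inverse)
    moreover have "1 * k \<le> exp (c * (y - x1)) * k"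
      using k c that by (intro mult_right_mono) auto
    ultimately show ?thesis by simp
  qed
  define y where "y = x1 + (a + 1) / k"
  have y: "x1 < y" using k a by (simp add: y_def)
  obtain \<xi> where \<xi>: "x1 < \<xi>" "\<xi> < y" "w y - w x1 = (y - x1) * w' \<xi>"
    using MVT2[OF y, of w w'] bounded_solution_deriv[OF w] x by (fastforce simp: x1_def)
  have "(y - x1) * k \<le> (y - x1) * w' \<xi>" using slope[of \<xi>] \<xi> y by (intro mult_left_mono) auto
  then have "a + 1 \<le> w y - w x1" using \<xi>(3) k by (simp add: y_def)
  then show False using D(5)[of y] D(4)[of x1] y x by (auto simp: x1_def)
qed

lemma bounded_solution_tendsto_0:
  assumes w: "bounded_solution c w w'" and c: "0 \<le> c"
  shows "(w \<longlongrightarrow> 0) at_top"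
proof -
  note D = bounded_solutionD[OF w]
  \<comment> \<open>A rate with \<open>t\<^sup>2 + c * t \<le> m\<close>, which makes \<open>a * exp (- t * x)\<close> a supersolution.\<close>
  define t where "t = min 1 (m / (1 + c))"
  have t: "0 < t" using m c by (simp add: t_def)
  have "t * (t + c) \<le> t * (1 + c)" using t by (intro mult_left_mono) (auto simp: t_def)
  also have "\<dots> \<le> m / (1 + c) * (1 + c)" using c by (intro mult_right_mono) (auto simp: t_def)
  also have "\<dots> = m" using c by simp
  finally have tm: "t * (t + c) \<le> m" .
  have upper: "w x - a * exp (- t * x) \<le> 0" if x: "0 \<le> x" for x
  proof (rule half_line_maximum_principle[OF c m _ _ _ _ _ _ x])
    show "continuous_on {0..} (\<lambda>x. w x - a * exp (- t * x))"
      by (intro continuous_intros bounded_solution_cont[OF w])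
    show "((\<lambda>x. w x - a * exp (- t * x)) has_real_derivative w' x + t * a * exp (- t * x)) (at x)"
      if "0 < x" for x
      by (rule derivative_eq_intros bounded_solution_deriv[OF w that] refl | simp)+
    show "((\<lambda>x. w' x + t * a * exp (- t * x)) has_real_derivative
        (c * w' x + G (w x)) - t\<^sup>2 * a * exp (- t * x)) (at x)" if "0 < x" for x
      by (rule derivative_eq_intros D(3)[OF that] refl | simp add: power2_eq_square)+
    show "w 0 - a * exp (- t * 0) \<le> 0" using D(5)[of 0] by simp
    show "w x - a * exp (- t * x) \<le> a" if "0 \<le> x" for x
      using D(5)[OF that] mult_pos_pos[OF a exp_gt_zero[of "- t * x"]] by linarith
    show "m * (w x - a * exp (- t * x)) \<le> (c * w' x + G (w x)) - t\<^sup>2 * a * exp (- t * x)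
        - c * (w' x + t * a * exp (- t * x))" if "0 < x" for x
    proof -
      have "m * w x \<le> G (w x)" using D(4,5)[of x] that by (intro G_bounds) auto
      moreover have "t * (t + c) * (a * exp (- t * x)) \<le> m * (a * exp (- t * x))"
        using tm a by (intro mult_right_mono) auto
      ultimately show ?thesis by (simp add: algebra_simps power2_eq_square)
    qed
  qed
  show ?thesis
  proof (rule tendsto_sandwich)
    show "\<forall>\<^sub>F x in at_top. 0 \<le> w x"
      using eventually_ge_at_top[of 0] by (rule eventually_mono) (rule D(4))
    show "\<forall>\<^sub>F x in at_top. w x \<le> a * exp (- t * x)"
      using eventually_ge_at_top[of 0] by (rule eventually_mono) (use upper in simp)
    have "filterlim (\<lambda>x. - t * x) at_bot at_top"
      by (rule filterlim_tendsto_neg_mult_at_bot[OF tendsto_const _ filterlim_ident]) (use t in simp)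
    then have "((\<lambda>x. exp (- t * x)) \<longlongrightarrow> 0) at_top"
      by (rule filterlim_compose[OF exp_at_bot])
    then show "((\<lambda>x. a * exp (- t * x)) \<longlongrightarrow> 0) at_top"
      by (rule tendsto_mult_right_zero)
  qed simp
qed

text \<open>
  A solution with speed \<open>c\<close> is a subsolution for speed \<open>d\<close> when the drift term has the right sign.
  The case \<open>c = d\<close> gives uniqueness; for decreasing \<open>w\<close> and \<open>c \<le> d\<close> it says that the larger speed
  does not have the steeper profile at the front.
\<close>

lemma bounded_solution_comparison:
  assumes w: "bounded_solution c w w'" and z: "bounded_solution d z z'"
    and d: "0 \<le> d" and start: "w 0 = z 0"
    and drift: "\<And>x. 0 \<le> x \<Longrightarrow> 0 \<le> (c - d) * w' x" and x: "0 \<le> x"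
  shows "w x \<le> z x"
proof -
  note D = bounded_solutionD[OF w] and E = bounded_solutionD[OF z]
  have "w x - z x \<le> 0"
  proof (rule half_line_maximum_principle[OF d m _ _ _ _ _ _ x])
    show "continuous_on {0..} (\<lambda>x. w x - z x)"
      by (intro continuous_intros bounded_solution_cont[OF w] bounded_solution_cont[OF z])
    show "((\<lambda>x. w x - z x) has_real_derivative w' x - z' x) (at x)" if "0 < x" for x
      by (rule derivative_eq_intros bounded_solution_deriv[OF w that] bounded_solution_deriv[OF z that] refl)+
    show "((\<lambda>x. w' x - z' x) has_real_derivative
        (c * w' x + G (w x)) - (d * z' x + G (z x))) (at x)" if "0 < x" for x
      by (rule derivative_eq_intros D(3)[OF that] E(3)[OF that] refl)+
    show "w 0 - z 0 \<le> 0" using start by simp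
    show "w x - z x \<le> a" if "0 \<le> x" for x using D(5)[OF that] E(4)[OF that] by simp
    show "m * (w x - z x) \<le> (c * w' x + G (w x)) - (d * z' x + G (z x)) - d * (w' x - z' x)"
      if "0 < x" "0 < w x - z x" for x
    proof -
      have "m * (w x - z x) \<le> G (w x) - G (z x)"
        using that D(4,5)[of x] E(4,5)[of x] by (intro incr) auto
      moreover have "0 \<le> (c - d) * w' x" using drift that by simp
      ultimately show ?thesis by (simp add: algebra_simps)
    qed
  qed
  then show ?thesis by simp
qed

lemma bounded_solution_unique:
  assumes w: "bounded_solution c w w'" and z: "bounded_solution c z z'"
    and c: "0 \<le> c" and start: "w 0 = z 0" and x: "0 \<le> x"
  shows "w x = z x"
  using bounded_solution_comparison[OF w z c start _ x]
    bounded_solution_comparison[OF z w c start[symmetric] _ x] by simp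

text \<open>
  Changing the speed perturbs the equation by \<open>(c - d) * z'\<close>, and \<open>\<bar>z'\<bar> \<le> \<nu> * a\<close>.  The barrier
  \<open>e / m * (1 - exp (- sqrt m * x))\<close> vanishes at \<open>0\<close> and dominates the response to a perturbation of
  size \<open>e\<close>; comparing slopes at \<open>0\<close> gives the estimate.
\<close>

lemma bounded_solution_slope_lipschitz_le:
  assumes w: "bounded_solution c w w'" and z: "bounded_solution d z z'"
    and cd: "0 \<le> c" "0 \<le> d" and start: "w 0 = z 0"
    and dec: "\<And>x. 0 \<le> x \<Longrightarrow> z' x \<le> 0"
  shows "w' 0 - z' 0 \<le> \<nu> * a / sqrt m * \<bar>c - d\<bar>"
proof -
  note D = bounded_solutionD[OF w] and E = bounded_solutionD[OF z]
  define e where "e = \<bar>c - d\<bar> * (\<nu> * a)"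
  define t where "t = sqrt m"
  have t: "0 < t" "t * t = m" using m by (auto simp: t_def)
  have e: "0 \<le> e" using \<nu> a by (simp add: e_def)
  define b where "b = (\<lambda>x. e / m * (1 - exp (- t * x)))"
  have b: "0 \<le> b x" if "0 \<le> x" for x using e m t that by (auto simp: b_def)
  have db: "(b has_real_derivative e / m * t * exp (- t * x)) (at x within S)" for x S
    unfolding b_def by (rule derivative_eq_intros refl | simp)+
  have below: "w x - z x - b x \<le> 0" if x: "0 \<le> x" for x
  proof (rule half_line_maximum_principle[OF cd(1) m _ _ _ _ _ _ x])
    show "continuous_on {0..} (\<lambda>x. w x - z x - b x)" unfolding b_def
      by (intro continuous_intros bounded_solution_cont[OF w] bounded_solution_cont[OF z])
    show "((\<lambda>x. w x - z x - b x) has_real_derivative w' x - z' x - e / m * t * exp (- t * x)) (at x)"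
      if "0 < x" for x
      by (rule derivative_eq_intros bounded_solution_deriv[OF w that] bounded_solution_deriv[OF z that] db refl)+
    show "((\<lambda>x. w' x - z' x - e / m * t * exp (- t * x)) has_real_derivative
        (c * w' x + G (w x)) - (d * z' x + G (z x)) + e * exp (- t * x)) (at x)" if "0 < x" for x
    proof (rule DERIV_cong)
      show "((\<lambda>x. w' x - z' x - e / m * t * exp (- t * x)) has_real_derivative
          (c * w' x + G (w x)) - (d * z' x + G (z x)) - e / m * t * (exp (- t * x) * - t)) (at x)"
        by (rule derivative_eq_intros D(3)[OF that] E(3)[OF that] refl | simp)+
      have "e / m * (t * t) * exp (- t * x) = e * exp (- t * x)" unfolding t(2) using m by simp
      then show "(c * w' x + G (w x)) - (d * z' x + G (z x)) - e / m * t * (exp (- t * x) * - t)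
          = (c * w' x + G (w x)) - (d * z' x + G (z x)) + e * exp (- t * x)"
        by (simp add: mult_ac)
    qed
    show "w 0 - z 0 - b 0 \<le> 0" using start by (simp add: b_def)
    show "w x - z x - b x \<le> a" if "0 \<le> x" for x using D(5)[OF that] E(4)[OF that] b[OF that] by simp
    show "m * (w x - z x - b x) \<le> (c * w' x + G (w x)) - (d * z' x + G (z x)) + e * exp (- t * x)
        - c * (w' x - z' x - e / m * t * exp (- t * x))"
      if "0 < x" "0 < w x - z x - b x" for x
    proof -
      have "m * (w x - z x) \<le> G (w x) - G (z x)"
        using that b[of x] D(4,5)[of x] E(4,5)[of x] by (intro incr) auto
      moreover have "- e \<le> (c - d) * z' x"
      proof -
        have "\<nu> * z x \<le> \<nu> * a" using E(5)[of x] that \<nu> by (intro mult_left_mono) auto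
        then have "\<bar>z' x\<bar> \<le> \<nu> * a"
          using dec[of x] bounded_solution_deriv_lower[OF z cd(2), of x] that by (simp add: abs_le_iff)
        then have "\<bar>(c - d) * z' x\<bar> \<le> e"
          unfolding e_def abs_mult by (intro mult_left_mono) auto
        then show ?thesis by (simp add: abs_le_iff)
      qed
      moreover have "0 \<le> c * (e / m * t * exp (- t * x))" using cd e m t by simp
      moreover have "m * b x = e - e * exp (- t * x)" using m by (simp add: b_def algebra_simps)
      ultimately show ?thesis by (simp add: algebra_simps)
    qed
  qed
  have "w' 0 - z' 0 - e / m * t * exp (- t * 0) \<le> 0"
  proof (rule right_derivative_nonpos)
    show "((\<lambda>x. w x - z x - b x) has_real_derivative w' 0 - z' 0 - e / m * t * exp (- t * 0)) (at 0 within {0..})"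
      by (rule derivative_eq_intros D(2) E(2) db refl | simp)+
    show "w 0 - z 0 - b 0 = 0" using start by (simp add: b_def)
  qed (rule below)
  moreover have "e / m * t = \<nu> * a / t * \<bar>c - d\<bar>"
  proof -
    have "e / m * t = e / (t * t) * t" by (simp only: t(2))
    then show ?thesis using t(1) by (simp add: e_def)
  qed
  ultimately show ?thesis by (simp add: t_def)
qed

text \<open>
  \<open>G\<close> may lie below its linearisation \<open>g * y\<close>, so the linearised solution \<open>Z\<close>, a multiple of
  \<open>exp (\<mu> * x)\<close>, need not be a supersolution.  Subtracting \<open>r * Z\<^sup>2\<close> gains a term
  \<open>(2 * \<mu>\<^sup>2 + g) * r * Z\<^sup>2\<close>, since the characteristic polynomial of the linearisation is positive at
  \<open>2 * \<mu>\<close>; with \<open>r = C / g\<close> this absorbs the quadratic error \<open>C * Z\<^sup>2\<close>.  The corrected function is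
  only positive for small \<open>Z\<close>, and the comparison starts where \<open>w\<close> is already small.
\<close>

lemma bounded_solution_exp_decay:
  assumes w: "bounded_solution c w w'" and c: "0 \<le> c"
    and g: "0 < g" and C: "0 < C"
    and G_lower: "\<And>y. 0 \<le> y \<Longrightarrow> y \<le> a \<Longrightarrow> g * y - C * y\<^sup>2 \<le> G y"
    and \<mu>: "\<mu> < 0" "\<mu>\<^sup>2 = c * \<mu> + g"
  shows "\<exists>K>0. \<forall>\<^sub>F x in at_top. w x \<le> K * exp (\<mu> * x)"
proof -
  note D = bounded_solutionD[OF w]
  define r where "r = C / g"
  \<comment> \<open>\<open>r * Z \<le> 1 / 2\<close> keeps \<open>Z - r * Z\<^sup>2\<close> between \<open>Z / 2\<close> and \<open>Z\<close>.\<close>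
  define z0 where "z0 = min a (1 / (2 * r))"
  have r: "0 < r" "r * g = C" using g C by (auto simp: r_def)
  have z0: "0 < z0" "z0 \<le> a" "r * z0 \<le> 1 / 2"
    using a r by (auto simp: z0_def min_def field_simps)
  have "\<forall>\<^sub>F x in at_top. w x < z0 / 2"
    using bounded_solution_tendsto_0[OF w c] z0 by (intro order_tendstoD) auto
  then have "\<forall>\<^sub>F x in at_top. w x < z0 / 2 \<and> 0 \<le> x"
    using eventually_ge_at_top by (rule eventually_conj)
  then obtain x1 where x1: "w x1 < z0 / 2" "0 \<le> x1"
    using eventually_happens by (metis (no_types, lifting) trivial_limit_at_top_linorder)
  define v v' where "v = (\<lambda>x. w (x1 + x))" and "v' = (\<lambda>x. w' (x1 + x))"
  have v: "bounded_solution c v v'"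
    unfolding v_def v'_def by (rule bounded_solution_shift[OF w x1(2)])
  note V = bounded_solutionD[OF v]
  define Z where "Z = (\<lambda>x. z0 * exp (\<mu> * x))"
  define W where "W = (\<lambda>x. Z x - r * (Z x)\<^sup>2)"
  have dZ: "(Z has_real_derivative \<mu> * Z x) (at x)" for x
    unfolding Z_def by (rule derivative_eq_intros refl | simp)+
  have Z: "0 < Z x" "Z x \<le> z0" if "0 \<le> x" for x
    using z0 \<mu> that by (auto simp: Z_def mult_nonpos_nonneg)
  have W: "0 \<le> W x" "W x \<le> Z x" "Z x / 2 \<le> W x" if "0 \<le> x" for x
  proof -
    have "r * Z x \<le> 1 / 2" using mult_left_mono[OF Z(2)[OF that], of r] r z0 by linarith
    then have "(r * Z x) * Z x \<le> 1 / 2 * Z x" using Z[OF that] by (intro mult_right_mono) auto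
    then show "0 \<le> W x" "W x \<le> Z x" "Z x / 2 \<le> W x"
      using Z[OF that] r by (auto simp: W_def power2_eq_square)
  qed
  have upper: "v x - W x \<le> 0" if x: "0 \<le> x" for x
  proof (rule half_line_maximum_principle[OF c m _ _ _ _ _ _ x])
    show "continuous_on {0..} (\<lambda>x. v x - W x)" unfolding W_def Z_def
      by (intro continuous_intros bounded_solution_cont[OF v])
    show "((\<lambda>x. v x - W x) has_real_derivative v' x - (\<mu> * Z x - 2 * r * \<mu> * (Z x)\<^sup>2)) (at x)"
      if "0 < x" for x unfolding W_def
      by (rule derivative_eq_intros bounded_solution_deriv[OF v that] dZ refl | simp add: power2_eq_square algebra_simps)+
    show "((\<lambda>x. v' x - (\<mu> * Z x - 2 * r * \<mu> * (Z x)\<^sup>2)) has_real_derivative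
        (c * v' x + G (v x)) - (\<mu>\<^sup>2 * Z x - 4 * r * \<mu>\<^sup>2 * (Z x)\<^sup>2)) (at x)" if "0 < x" for x
      by (rule derivative_eq_intros V(3)[OF that] dZ refl | simp add: power2_eq_square algebra_simps)+
    show "v 0 - W 0 \<le> 0" using W(3)[of 0] x1 by (simp add: v_def Z_def)
    show "v x - W x \<le> a" if "0 \<le> x" for x using V(5)[OF that] W(1)[OF that] by simp
    show "m * (v x - W x) \<le> (c * v' x + G (v x)) - (\<mu>\<^sup>2 * Z x - 4 * r * \<mu>\<^sup>2 * (Z x)\<^sup>2)
        - c * (v' x - (\<mu> * Z x - 2 * r * \<mu> * (Z x)\<^sup>2))"
      if "0 < x" "0 < v x - W x" for x
    proof -
      have x: "0 \<le> x" using that by simp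
      have "m * (v x - W x) \<le> G (v x) - G (W x)"
        using that W[OF x] V(4,5)[OF x] by (intro incr) auto
      moreover have "g * W x - C * (W x)\<^sup>2 \<le> G (W x)"
        using W[OF x] Z[OF x] z0 by (intro G_lower) auto
      moreover have "C * (W x)\<^sup>2 \<le> C * (Z x)\<^sup>2"
        using W[OF x] C by (intro mult_left_mono power_mono) auto
      moreover have "g * W x = g * Z x - C * (Z x)\<^sup>2"
        using r by (simp add: W_def algebra_simps)
      moreover have "\<mu>\<^sup>2 * Z x - 4 * r * \<mu>\<^sup>2 * (Z x)\<^sup>2 - c * (\<mu> * Z x - 2 * r * \<mu> * (Z x)\<^sup>2)
          = g * Z x - 2 * r * (\<mu>\<^sup>2 + g) * (Z x)\<^sup>2"
      proof -
        have "c * \<mu> = \<mu>\<^sup>2 - g" using \<mu> by simp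
        then have "c * (\<mu> * Z x - 2 * r * \<mu> * (Z x)\<^sup>2) = (\<mu>\<^sup>2 - g) * Z x - 2 * r * (\<mu>\<^sup>2 - g) * (Z x)\<^sup>2"
          by (metis (no_types, opaque_lifting) mult.assoc mult.left_commute right_diff_distrib)
        then show ?thesis by (simp add: algebra_simps)
      qed
      moreover have "2 * C * (Z x)\<^sup>2 \<le> 2 * r * (\<mu>\<^sup>2 + g) * (Z x)\<^sup>2"
        using r by (intro mult_right_mono) (auto simp: algebra_simps)
      ultimately show ?thesis by (simp add: algebra_simps)
    qed
  qed
  have "w x \<le> z0 * exp (- \<mu> * x1) * exp (\<mu> * x)" if "x1 \<le> x" for x
  proof -
    have "w x \<le> Z (x - x1)"
      using upper[of "x - x1"] W(2)[of "x - x1"] that by (simp add: v_def)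
    also have "\<dots> = z0 * exp (- \<mu> * x1) * exp (\<mu> * x)"
      by (simp add: Z_def algebra_simps flip: exp_add)
    finally show ?thesis .
  qed
  then have "\<forall>\<^sub>F x in at_top. w x \<le> z0 * exp (- \<mu> * x1) * exp (\<mu> * x)"
    using eventually_at_top_linorder by blast
  then show ?thesis using z0(1)
    by (intro exI[of _ "z0 * exp (- \<mu> * x1)"]) auto
qed

section \<open>The slope at the front as a function of the speed\<close>

lemma ex_slope_function:
  "\<exists>P. continuous_on {0..} P \<and> (\<forall>c\<ge>0. 0 < P c \<and> P c \<le> \<nu> * a \<and>
     (\<exists>w w'. bounded_solution c w w' \<and> w 0 = a \<and> w' 0 = - P c))"
proof -
  obtain w w' where w: "\<And>c. 0 \<le> c \<Longrightarrow> bounded_solution c (w c) (w' c)" "\<And>c. 0 \<le> c \<Longrightarrow> w c 0 = a"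
    using ex_bounded_solution by metis
  have pos: "0 < w c x" if "0 \<le> c" "0 \<le> x" for c x
    using bounded_solution_pos[OF w(1)[OF that(1)] that(1) _ that(2)] w(2)[OF that(1)] a by simp
  have dec: "w' c x < 0" if "0 \<le> c" "0 \<le> x" for c x
    using bounded_solution_decreasing[OF w(1)[OF that(1)] that(1) _ that(2)] pos[OF that(1)] by blast
  define L where "L = \<nu> * a / sqrt m"
  have step: "w' c 0 - w' d 0 \<le> L * \<bar>c - d\<bar>" if "0 \<le> c" "0 \<le> d" for c d
    unfolding L_def
    by (rule bounded_solution_slope_lipschitz_le[OF w(1) w(1) that])
       (use that w(2) dec[of d] in \<open>auto simp: less_imp_le\<close>)
  have "0 \<le> L" using \<nu> a m by (simp add: L_def)
  then have "continuous_on {0..} (\<lambda>c. - w' c 0)"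
  proof (intro lipschitz_on_continuous_on[of L] lipschitz_onI)
    fix c d :: real assume "c \<in> {0..}" "d \<in> {0..}"
    then show "dist (- w' c 0) (- w' d 0) \<le> L * dist c d"
      using step[of c d] step[of d c] by (simp add: dist_real_def abs_le_iff abs_minus_commute)
  qed
  moreover have "0 < - w' c 0 \<and> - w' c 0 \<le> \<nu> * a" if "0 \<le> c" for c
    using dec[OF that, of 0] bounded_solution_deriv_lower[OF w(1)[OF that] that, of 0] w(2)[OF that] by simp
  ultimately show ?thesis
    using w by (intro exI[of _ "\<lambda>c. - w' c 0"]) (metis minus_minus)
qed

end

section \<open>The zone of constant heat release\<close>

text \<open>
  The solution of \<open>\<phi>' = c * \<phi> - q * x\<close> with \<open>\<phi> 0 = b\<close>: this is the first integral of
  \<open>\<phi>'' - c * \<phi>' + q = 0\<close> that fits the flow \<open>\<theta>' = c * \<theta>\<close> on the cold side.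
\<close>

definition ignited_profile :: "real \<Rightarrow> real \<Rightarrow> real \<Rightarrow> real \<Rightarrow> real" where
  "ignited_profile q b c x = q * x / c + q / c\<^sup>2 + (b - q / c\<^sup>2) * exp (c * x)"

lemma ignited_profile_0 [simp]: "ignited_profile q b c 0 = b"
  by (simp add: ignited_profile_def)

lemma ignited_profile_deriv:
  assumes "c \<noteq> 0"
  shows "(ignited_profile q b c has_real_derivative c * ignited_profile q b c x - q * x) (at x within S)"
proof -
  have "ignited_profile q b c = (\<lambda>x. q * x / c + q / c\<^sup>2 + (b - q / c\<^sup>2) * exp (c * x))"
    by (simp add: ignited_profile_def fun_eq_iff)
  moreover have "((\<lambda>x. q * x / c + q / c\<^sup>2 + (b - q / c\<^sup>2) * exp (c * x)) has_real_derivative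
      q / c + (b - q / c\<^sup>2) * (exp (c * x) * c)) (at x within S)"
    by (rule derivative_eq_intros refl | use assms in simp)+
  moreover have "q / c + (b - q / c\<^sup>2) * (exp (c * x) * c) = c * ignited_profile q b c x - q * x"
    using assms by (simp add: ignited_profile_def field_simps power2_eq_square)
  ultimately show ?thesis by simp
qed

lemma linear_ode_exp:
  fixes d :: "real \<Rightarrow> real"
  assumes cont: "continuous_on {s..t} d" and st: "s \<le> t"
    and ode: "\<And>x. s < x \<Longrightarrow> x < t \<Longrightarrow> (d has_real_derivative c * d x) (at x)"
  shows "d t = d s * exp (c * (t - s))"
proof (cases "s = t")
  case False
  define p where "p = (\<lambda>x. d x * exp (- c * x))"
  have "p t = p s"
  proof (rule DERIV_isconst_end[of s t p])
    show "continuous_on {s..t} p" unfolding p_def by (intro continuous_intros cont)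
    show "(p has_real_derivative 0) (at x)" if "s < x" "x < t" for x
      unfolding p_def by (rule derivative_eq_intros ode that refl | simp)+
  qed (use False st in simp)
  then have "exp (c * t) * (exp (- c * t) * d t) = exp (c * t) * (exp (- c * s) * d s)"
    by (simp add: p_def mult.commute)
  then have "d t = exp (c * t) * (exp (- c * s) * d s)" by (simp only: exp_mult_cancel)
  then show ?thesis by (simp add: algebra_simps exp_diff exp_minus divide_inverse)
qed simp

text \<open>
  The slope is \<open>q / c\<close> plus a multiple of \<open>exp (c * x)\<close>; it is either always positive or decreasing,
  so positivity propagates to the left.
\<close>

lemma ignited_slope_pos:
  assumes c: "0 < c" and q: "0 < q" and x: "x \<le> R"
    and R: "0 < c * ignited_profile q b c R - q * R"
  shows "0 < c * ignited_profile q b c x - q * x"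
proof -
  have slope: "c * ignited_profile q b c x - q * x = q / c + (c * b - q / c) * exp (c * x)" for x
    using c by (simp add: ignited_profile_def field_simps power2_eq_square)
  show ?thesis
  proof (cases "0 \<le> c * b - q / c")
    case True
    then show ?thesis unfolding slope using c q by (intro add_pos_nonneg) auto
  next
    case False
    then have "(c * b - q / c) * exp (c * R) \<le> (c * b - q / c) * exp (c * x)"
      using c x by (intro mult_left_mono_neg) auto
    then show ?thesis using R unfolding slope by linarith
  qed
qed

text \<open>
  \<open>P\<close> is the slope that the right-hand zone requires at the front.  The first integral
  expresses \<open>R\<close> through \<open>c\<close>, and what remains is \<open>ignited_profile q b c R = e\<close>.  With \<open>s = c * R\<close>, and
  multiplied by \<open>- c\<^sup>2 * exp (- s)\<close>, it becomes \<open>H c = 0\<close> below.  At positive speeds \<open>H\<close> is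
  positive wherever \<open>s \<le> 0\<close>, so a zero there automatically has \<open>R > 0\<close>.
\<close>

lemma ex_matching_speed:
  fixes P :: "real \<Rightarrow> real"
  assumes q: "0 < q" and b: "0 < b" "b < e"
    and P: "continuous_on {0..} P" "\<And>c. 0 \<le> c \<Longrightarrow> 0 < P c" "\<And>c. 0 \<le> c \<Longrightarrow> P c \<le> B"
  shows "\<exists>c>0. \<exists>R>0. ignited_profile q b c R = e \<and> P c = c * e - q * R"
proof -
  define s where "s = (\<lambda>c. c * (c * e - P c) / q)"
  define H where "H = (\<lambda>c. q * (1 - (1 + s c) * exp (- s c)) - c\<^sup>2 * (b - e * exp (- s c)))"
  have e: "0 < e" using b by simp
  have B: "0 < B" using P(2)[of 0] P(3)[of 0] by simp
  have Pc: "continuous_on {x..y} P" if "0 \<le> x" for x y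
    using P(1) by (rule continuous_on_subset) (use that in auto)
  have H_cont: "continuous_on {x..y} H" if "0 \<le> x" for x y
    unfolding H_def s_def using q by (intro continuous_intros Pc that) auto
  have H_pos: "0 < H c" if "0 < c" "s c \<le> 0" for c
  proof -
    have "(1 + s c) * exp (- s c) \<le> exp (s c) * exp (- s c)"
      by (intro mult_right_mono) (auto simp: exp_ge_add_one_self)
    then have "0 \<le> q * (1 - (1 + s c) * exp (- s c))" using q by (simp add: exp_minus)
    moreover have "e * 1 \<le> e * exp (- s c)" using e that by (intro mult_left_mono) auto
    then have "b - e * exp (- s c) < 0" using b by linarith
    then have "c\<^sup>2 * (b - e * exp (- s c)) < 0"
      using that by (intro mult_pos_neg) auto
    ultimately show ?thesis by (simp add: H_def)
  qed
  \<comment> \<open>The speed \<open>c0\<close> is the one for which \<open>R = 0\<close>; there \<open>H\<close> is positive.\<close>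
  have "continuous_on {0..B / e} (\<lambda>c. c * e - P c)" by (intro continuous_intros Pc) simp
  then obtain c0 where c0: "0 \<le> c0" "c0 \<le> B / e" "c0 * e - P c0 = 0"
    using IVT'[of "\<lambda>c. c * e - P c" 0 0 "B / e"] P(2)[of 0] P(3)[of "B / e"] B e
    by auto
  then have c0_pos: "0 < c0" using P(2)[of 0] by (cases "c0 = 0") auto
  \<comment> \<open>At \<open>c1\<close>, \<open>P\<close> is at most half of \<open>c * e\<close>, so \<open>s\<close> is large enough to make
      \<open>c\<^sup>2 * e * exp (- s)\<close> at most \<open>2 * q\<close>, whereas \<open>c\<^sup>2 * b\<close> is at least \<open>3 * q\<close>.\<close>
  define c1 where "c1 = 2 * B / e + 3 * q / b + 1"
  have "0 \<le> B / e" "0 \<le> q / b" using B e q b by auto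
  then have c1: "1 \<le> c1" "c0 \<le> c1" "2 * B / e \<le> c1" "3 * q / b < c1" using c0 by (auto simp: c1_def)
  have "H c1 \<le> 0"
  proof -
    have sq: "c1 \<le> c1\<^sup>2" using c1 by (simp add: power2_eq_square)
    have "2 * B \<le> c1 * e" using c1(3) e by (simp add: pos_divide_le_eq)
    then have "c1 * e / 2 \<le> c1 * e - P c1" using P(3)[of c1] c1 by simp
    then have "c1 * (c1 * e / 2) / q \<le> s c1" unfolding s_def
      using c1 q by (intro divide_right_mono mult_left_mono) auto
    then have lower: "c1\<^sup>2 * e \<le> 2 * q * s c1" using q by (simp add: field_simps power2_eq_square)
    have "0 < c1\<^sup>2 * e" using c1 e by simp
    then have s: "0 < s c1" using lower q by (smt (verit) mult_nonneg_nonpos)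
    have "s c1 * exp (- s c1) \<le> exp (s c1) * exp (- s c1)"
      using order_trans[OF _ exp_ge_add_one_self, of "s c1" "s c1"] by (intro mult_right_mono) auto
    then have "s c1 * exp (- s c1) \<le> 1" by (simp add: exp_minus)
    then have "2 * q * (s c1 * exp (- s c1)) \<le> 2 * q * 1" using q by (intro mult_left_mono) auto
    moreover have "c1\<^sup>2 * e * exp (- s c1) \<le> 2 * q * s c1 * exp (- s c1)"
      using lower by (intro mult_right_mono) auto
    ultimately have "c1\<^sup>2 * e * exp (- s c1) \<le> 2 * q" unfolding mult.assoc by linarith
    moreover have "3 * q \<le> c1\<^sup>2 * b"
    proof -
      have "3 * q \<le> c1 * b" using c1(4) b by (simp add: pos_divide_less_eq)
      also have "\<dots> \<le> c1\<^sup>2 * b" using sq b by simp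
      finally show ?thesis .
    qed
    moreover have "0 \<le> q * ((1 + s c1) * exp (- s c1))" using q s by simp
    ultimately show ?thesis by (simp add: H_def algebra_simps)
  qed
  moreover have "0 \<le> H c0" using H_pos[OF c0_pos] c0 by (simp add: s_def)
  ultimately obtain c where c: "c0 \<le> c" "H c = 0"
    using IVT2'[of H c1 0 c0] c1 H_cont c0 by auto
  have c_pos: "0 < c" using c c0_pos by simp
  have s_pos: "0 < s c" using H_pos[OF c_pos] c by force
  define R where "R = s c / c"
  have R: "0 < R" "c * R = s c" using s_pos c_pos by (auto simp: R_def)
  have "P c = c * e - q * R" using c_pos q by (simp add: R_def s_def)
  moreover have "ignited_profile q b c R = e"
  proof -
    have "exp (s c) * H c = q * exp (s c) - q * (1 + s c) - c\<^sup>2 * b * exp (s c) + c\<^sup>2 * e"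
      by (simp add: H_def algebra_simps exp_minus)
    then have "c\<^sup>2 * e = q * (1 + s c) + (c\<^sup>2 * b - q) * exp (s c)"
      using c by (simp add: algebra_simps)
    also have "\<dots> = c\<^sup>2 * ignited_profile q b c R"
      using c_pos R(2)[symmetric] by (simp add: ignited_profile_def algebra_simps power2_eq_square)
    finally show ?thesis using c_pos by simp
  qed
  ultimately show ?thesis using c_pos R(1) by blast
qed

section \<open>Gluing and classical solutions\<close>

lemma glue_deriv:
  fixes f g :: "real \<Rightarrow> real"
  assumes f: "\<And>x. x \<le> p \<Longrightarrow> (f has_real_derivative f' x) (at x within {..p})"
    and g: "\<And>x. p \<le> x \<Longrightarrow> (g has_real_derivative g' x) (at x within {p..})"
    and eq: "f p = g p" "f' p = g' p"
  shows "((\<lambda>x. if x \<le> p then f x else g x) has_real_derivative (if x \<le> p then f' x else g' x)) (at x)"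
    (is "(?h has_real_derivative _) _")
proof -
  have left: "(?h has_real_derivative f' x) (at x within {..p})" if "x \<le> p" for x
    by (rule has_field_derivative_transform_within[OF f[OF that], of 1]) (use that in auto)
  have right: "(?h has_real_derivative g' x) (at x within {p..})" if "p \<le> x" for x
    by (rule has_field_derivative_transform_within[OF g[OF that], of 1]) (use that eq in auto)
  consider "x < p" | "x = p" | "p < x" by linarith
  then show ?thesis
  proof cases
    case 1
    then have "at x within {..p} = at x" by (intro at_within_interior) simp
    then show ?thesis using left[of x] 1 by simp
  next
    case 3
    then have "at x within {p..} = at x" by (intro at_within_interior) simp
    then show ?thesis using right[of x] 3 by simp
  next
    case 2
    have "{..p} \<union> {p..} = UNIV" by auto
    then have "(?h has_real_derivative f' p) (at p within UNIV)"
      using left[of p] right[of p] eq(2) unfolding has_field_derivative_iff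
      by (metis (no_types, lifting) Lim_within_Un order_refl)
    then show ?thesis using 2 by simp
  qed
qed

lemma glue_continuous:
  fixes f g :: "real \<Rightarrow> real"
  assumes "continuous_on {..p} f" "continuous_on {p..} g" "f p = g p"
  shows "continuous_on UNIV (\<lambda>x. if x \<le> p then f x else g x)"
  by (rule continuous_on_cases_le) (use assms in \<open>auto simp: atMost_def atLeast_def continuous_on_id\<close>)

lemma classical_solution_onI:
  assumes "\<And>x. (\<theta> has_real_derivative D x) (at x)"
    and "\<And>x. x \<in> I \<Longrightarrow> (D has_real_derivative c * D x - g (\<theta> x)) (at x)"
  shows "classical_solution_on I c g \<theta>"
proof -
  have "deriv \<theta> = D" using assms(1) by (auto intro: DERIV_imp_deriv)
  then show ?thesis unfolding classical_solution_on_def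
    using assms DERIV_imp_deriv[OF assms(2)] by (auto simp: real_differentiable_def)
qed

lemma classical_solution_onD:
  assumes "classical_solution_on I c g \<theta>" "x \<in> I"
  shows "(deriv \<theta> has_real_derivative c * deriv \<theta> x - g (\<theta> x)) (at x)"
proof -
  have "deriv \<theta> differentiable (at x)" "deriv (deriv \<theta>) x - c * deriv \<theta> x + g (\<theta> x) = 0"
    using assms by (auto simp: classical_solution_on_def)
  then show ?thesis
    by (metis DERIV_deriv_iff_real_differentiable add_diff_cancel_right' add_diff_eq
        diff_add_cancel diff_add_eq diff_diff_eq2 add.commute diff_0 minus_diff_eq)
qed

lemma no_jump_at_of_continuous:
  assumes "continuous_on UNIV f"
  shows "no_jump_at f a"
  unfolding no_jump_at_def
  using assms by (intro exI[of _ "f a"])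
    (auto simp: continuous_on_eq_continuous_at isCont_def filterlim_at_split)

section \<open>The Stefan-Boltzmann heat loss as an increasing reaction\<close>

lemma theta_plus_power4:
  assumes "0 < q" "0 < h"
  shows "(1 + theta_plus q h) ^ 4 = 1 + q / h"
proof -
  have "0 < q / h" using assms by simp
  then have "((1 + q / h) powr (1 / 4)) ^ 4 = (1 + q / h) powr (1 / 4 * 4)"
    by (simp flip: powr_numeral add: powr_powr)
  then show ?thesis using \<open>0 < q / h\<close> by (simp add: theta_plus_def)
qed

lemma F_below_theta_plus:
  assumes "0 < q" "0 < h"
  shows "F q h (theta_plus q h - w) = h * ((1 + theta_plus q h) ^ 4 - (1 + theta_plus q h - w) ^ 4)"
  using assms theta_plus_power4[OF assms] by (simp add: F_def algebra_simps)

lemma deriv_F: "deriv (F q h) t = - 4 * h * (1 + t) ^ 3"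
proof (rule DERIV_imp_deriv)
  have "F q h = (\<lambda>t. q - h * ((1 + t) ^ 4 - 1))" by (simp add: F_def fun_eq_iff)
  moreover have "((\<lambda>t. q - h * ((1 + t) ^ 4 - 1)) has_real_derivative - 4 * h * (1 + t) ^ 3) (at t)"
    by (rule derivative_eq_intros refl | simp)+
  ultimately show "(F q h has_real_derivative - 4 * h * (1 + t) ^ 3) (at t)" by simp
qed

lemma quartic_difference:
  fixes s t :: real
  assumes "1 \<le> s" "s \<le> t" "t \<le> A"
  shows "4 * (t - s) \<le> t ^ 4 - s ^ 4" and "t ^ 4 - s ^ 4 \<le> 4 * A ^ 3 * (t - s)"
proof -
  have e: "t ^ 4 - s ^ 4 = (t ^ 3 + t\<^sup>2 * s + t * s\<^sup>2 + s ^ 3) * (t - s)"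
    by (simp add: algebra_simps power2_eq_square power3_eq_cube power4_eq_xxxx)
  have lower: "1 \<le> x * y * z" if "1 \<le> x" "1 \<le> y" "1 \<le> z" for x y z :: real
    using mult_mono[of 1 x 1 y] mult_mono[of 1 "x * y" 1 z] that by simp
  have upper: "x * y * z \<le> A * A * A" if "0 \<le> x" "0 \<le> y" "0 \<le> z" "x \<le> A" "y \<le> A" "z \<le> A" for x y z :: real
    using that by (intro mult_mono) auto
  have "4 \<le> t ^ 3 + t\<^sup>2 * s + t * s\<^sup>2 + s ^ 3"
    using lower[of t t t] lower[of t t s] lower[of t s s] lower[of s s s] assms
    by (simp add: power2_eq_square power3_eq_cube mult.assoc)
  then show "4 * (t - s) \<le> t ^ 4 - s ^ 4"
    unfolding e using assms by (intro mult_right_mono) auto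
  have "t ^ 3 + t\<^sup>2 * s + t * s\<^sup>2 + s ^ 3 \<le> 4 * A ^ 3"
    using upper[of t t t] upper[of t t s] upper[of t s s] upper[of s s s] assms
    by (simp add: power2_eq_square power3_eq_cube mult.assoc)
  then show "t ^ 4 - s ^ 4 \<le> 4 * A ^ 3 * (t - s)"
    unfolding e using assms by (intro mult_right_mono) auto
qed

locale flame =
  fixes q h \<theta>ig \<theta>hl :: real
  assumes q: "0 < q" and h: "0 < h"
    and ig: "0 < \<theta>ig" and ig_hl: "\<theta>ig < \<theta>hl" and hl: "\<theta>hl < theta_plus q h"
begin

abbreviation "\<theta>p \<equiv> theta_plus q h"

abbreviation "G \<equiv> (\<lambda>w. F q h (\<theta>p - w))"

lemmas G_eq = F_below_theta_plus[OF q h]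

sublocale monotone_reaction G "\<theta>p - \<theta>hl" "4 * h" "sqrt (4 * h * (1 + \<theta>p) ^ 3)"
proof
  show "0 < \<theta>p - \<theta>hl" using hl by simp
  show "0 < 4 * h" using h by simp
  show "0 < sqrt (4 * h * (1 + \<theta>p) ^ 3)" using h ig ig_hl hl by simp
  show "G 0 = 0" using G_eq[of 0] by simp
  fix y z assume yz: "0 \<le> y" "y \<le> z" "z \<le> \<theta>p - \<theta>hl"
  define A where "A = 1 + \<theta>p"
  have d: "G z - G y = h * ((A - y) ^ 4 - (A - z) ^ 4)"
    by (simp add: G_eq A_def algebra_simps)
  note Q = quartic_difference[of "A - z" "A - y" A]
  have r: "1 \<le> A - z" "A - z \<le> A - y" "A - y \<le> A" using yz ig ig_hl by (auto simp: A_def)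
  show "4 * h * (z - y) \<le> G z - G y"
    unfolding d using mult_left_mono[OF Q(1)[OF r], of h] h by (simp add: algebra_simps)
  have "0 \<le> 4 * h * A ^ 3" using h r yz by simp
  then show "G z - G y \<le> (sqrt (4 * h * (1 + \<theta>p) ^ 3))\<^sup>2 * (z - y)"
    unfolding d using mult_left_mono[OF Q(2)[OF r], of h] h by (simp add: algebra_simps A_def[symmetric])
qed

text \<open>
  The linear coefficient is \<open>- F'(\<theta>\<^sub>+)\<close>, the one in the definition of \<open>\<lambda>\<^sub>-\<close>.
\<close>

lemma G_lower:
  assumes "0 \<le> w" "w \<le> \<theta>p - \<theta>hl"
  shows "4 * h * (1 + \<theta>p) ^ 3 * w - 6 * h * (1 + \<theta>p)\<^sup>2 * w\<^sup>2 \<le> G w"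
proof -
  define A where "A = 1 + \<theta>p"
  have "w \<le> 4 * A" using assms ig ig_hl hl by (simp add: A_def)
  then have "0 \<le> h * (w ^ 3 * (4 * A - w))" using assms h by simp
  moreover have "G w = 4 * h * A ^ 3 * w - 6 * h * A\<^sup>2 * w\<^sup>2 + h * (w ^ 3 * (4 * A - w))"
    unfolding G_eq A_def[symmetric]
    by (simp add: algebra_simps power2_eq_square power3_eq_cube power4_eq_xxxx)
  ultimately show ?thesis by (simp add: A_def)
qed

section \<open>The three zones of an arbitrary solution\<close>

text \<open>
  On the cold side \<open>\<theta>' - c * \<theta>\<close> is a constant \<open>k\<close>,
  so \<open>\<theta> + k / c\<close> is a multiple of \<open>exp (c * x)\<close> and the limit at \<open>-\<infinity>\<close> forces \<open>k = 0\<close>.  Continuity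
  of \<open>\<theta>'\<close> carries the value \<open>c * \<theta>ig\<close> of the slope across \<open>0\<close>, which fixes the first integral in
  the middle zone.
\<close>

lemma system_pieces:
  assumes C1: "\<theta> C1_differentiable_on UNIV"
    and sys: "free_interface_system q h \<theta>ig \<theta>hl R c \<theta>"
  shows "(\<theta> has_real_derivative deriv \<theta> x) (at x)"
    and "x \<le> 0 \<Longrightarrow> \<theta> x = \<theta>ig * exp (c * x)"
    and "0 \<le> x \<Longrightarrow> x \<le> R \<Longrightarrow> deriv \<theta> x = c * \<theta> x - q * x"
    and "0 \<le> x \<Longrightarrow> x \<le> R \<Longrightarrow> \<theta> x = ignited_profile q \<theta>ig c x"
    and "bounded_solution c (\<lambda>x. \<theta>p - \<theta> (R + x)) (\<lambda>x. - deriv \<theta> (R + x))"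
proof -
  obtain D where D: "\<And>x. (\<theta> has_real_derivative D x) (at x)" "continuous_on UNIV D"
    using C1 by (auto simp: C1_differentiable_on_def has_real_derivative_iff_has_vector_derivative)
  have D_eq: "deriv \<theta> = D" using D(1) by (auto intro: DERIV_imp_deriv)
  show d\<theta>: "(\<theta> has_real_derivative deriv \<theta> x) (at x)" for x using D(1) by (simp add: D_eq)
  have cont: "continuous_on S \<theta>" "continuous_on S (deriv \<theta>)" for S
  proof -
    show "continuous_on S \<theta>"
      by (intro continuous_at_imp_continuous_on ballI DERIV_isCont[OF D(1)])
    show "continuous_on S (deriv \<theta>)"
      unfolding D_eq by (rule continuous_on_subset[OF D(2)]) simp
  qed
  have S: "0 < R" "0 < c" "(\<theta> \<longlongrightarrow> 0) at_bot" "\<theta> 0 = \<theta>ig" "\<theta> R = \<theta>hl"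
    and pde: "classical_solution_on {..<0} c (\<lambda>_. 0) \<theta>" "classical_solution_on {0<..<R} c (\<lambda>_. q) \<theta>"
      "classical_solution_on {R<..} c (F q h) \<theta>"
    and bound: "\<forall>x\<in>{R<..}. \<theta>hl < \<theta> x \<and> \<theta> x < \<theta>p"
    using sys by (auto simp: free_interface_system_def)
  define k where "k = deriv \<theta> 0 - c * \<theta>ig"
  have first_integral: "deriv \<theta> x = c * \<theta> x + k" if "x \<le> 0" for x
  proof (cases "x = 0")
    case False
    have "deriv \<theta> 0 - c * \<theta> 0 = deriv \<theta> x - c * \<theta> x"
    proof (rule DERIV_isconst_end[of x 0 "\<lambda>x. deriv \<theta> x - c * \<theta> x"])
      show "continuous_on {x..0} (\<lambda>x. deriv \<theta> x - c * \<theta> x)" by (intro continuous_intros cont)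
      show "((\<lambda>x. deriv \<theta> x - c * \<theta> x) has_real_derivative 0) (at y)" if "x < y" "y < 0" for y
        by (rule derivative_eq_intros classical_solution_onD[OF pde(1)] d\<theta> refl | use that in simp)+
    qed (use that False in simp)
    then show ?thesis by (simp add: k_def S(4))
  qed (simp add: k_def S(4))
  have shifted: "\<theta> x + k / c = (\<theta>ig + k / c) * exp (c * x)" if "x \<le> 0" for x
  proof -
    have "\<theta> 0 + k / c = (\<theta> x + k / c) * exp (c * (0 - x))"
    proof (rule linear_ode_exp[OF _ that])
      show "continuous_on {x..0} (\<lambda>x. \<theta> x + k / c)" by (intro continuous_intros cont)
      show "((\<lambda>x. \<theta> x + k / c) has_real_derivative c * (\<theta> y + k / c)) (at y)" if "y < 0" for y
        by (rule derivative_eq_intros d\<theta> refl)+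
           (use S(2) first_integral[of y] that in \<open>simp add: algebra_simps\<close>)
    qed
    then show ?thesis by (simp add: S(4) exp_minus field_simps)
  qed
  have "filterlim (\<lambda>x. c * x) at_bot at_bot"
    by (rule filterlim_tendsto_pos_mult_at_bot[OF tendsto_const S(2) filterlim_ident])
  then have "((\<lambda>x. exp (c * x)) \<longlongrightarrow> 0) at_bot" by (rule filterlim_compose[OF exp_at_bot])
  then have "((\<lambda>x. (\<theta>ig + k / c) * exp (c * x)) \<longlongrightarrow> 0) at_bot" by (rule tendsto_mult_right_zero)
  moreover have "\<forall>\<^sub>F x in at_bot. (\<theta>ig + k / c) * exp (c * x) = \<theta> x + k / c"
    using eventually_le_at_bot[of 0] by (rule eventually_mono) (simp add: shifted)
  ultimately have "((\<lambda>x. \<theta> x + k / c) \<longlongrightarrow> 0) at_bot" by (rule Lim_transform_eventually)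
  moreover have "((\<lambda>x. \<theta> x + k / c) \<longlongrightarrow> 0 + k / c) at_bot"
    by (intro tendsto_intros S(3))
  ultimately have "k / c = 0" by (metis add_0 tendsto_unique trivial_limit_at_bot_linorder)
  then have k: "k = 0" using S(2) by simp
  show "\<theta> x = \<theta>ig * exp (c * x)" if "x \<le> 0" for x using shifted[OF that] k by simp
  show slope: "deriv \<theta> x = c * \<theta> x - q * x" if x: "0 \<le> x" "x \<le> R" for x
  proof -
    have "deriv \<theta> x - c * \<theta> x + q * x = deriv \<theta> 0 - c * \<theta> 0 + q * 0"
    proof (rule DERIV_isconst2[of 0 R "\<lambda>x. deriv \<theta> x - c * \<theta> x + q * x", OF S(1) _ _ x])
      show "continuous_on {0..R} (\<lambda>x. deriv \<theta> x - c * \<theta> x + q * x)" by (intro continuous_intros cont)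
      show "((\<lambda>x. deriv \<theta> x - c * \<theta> x + q * x) has_real_derivative 0) (at y)" if "0 < y" "y < R" for y
        by (rule derivative_eq_intros classical_solution_onD[OF pde(2)] d\<theta> refl | use that in simp)+
    qed
    then show ?thesis using k by (simp add: k_def S(4))
  qed
  show "\<theta> x = ignited_profile q \<theta>ig c x" if x: "0 \<le> x" "x \<le> R" for x
  proof -
    have dI: "(ignited_profile q \<theta>ig c has_real_derivative c * ignited_profile q \<theta>ig c y - q * y) (at y)" for y
      using S(2) by (intro ignited_profile_deriv) simp
    have "\<theta> x - ignited_profile q \<theta>ig c x = (\<theta> 0 - ignited_profile q \<theta>ig c 0) * exp (c * (x - 0))"
    proof (rule linear_ode_exp[OF _ x(1)])
      have "continuous_on {0..x} (ignited_profile q \<theta>ig c)"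
        by (auto intro!: continuous_at_imp_continuous_on DERIV_isCont[OF dI])
      then show "continuous_on {0..x} (\<lambda>x. \<theta> x - ignited_profile q \<theta>ig c x)"
        by (intro continuous_intros cont)
      show "((\<lambda>x. \<theta> x - ignited_profile q \<theta>ig c x) has_real_derivative
          c * (\<theta> y - ignited_profile q \<theta>ig c y)) (at y)" if "0 < y" "y < x" for y
        by (rule derivative_eq_intros d\<theta> dI refl)+
           (use slope[of y] that x in \<open>simp add: algebra_simps\<close>)
    qed
    then show ?thesis by (simp add: S(4))
  qed
  show "bounded_solution c (\<lambda>x. \<theta>p - \<theta> (R + x)) (\<lambda>x. - deriv \<theta> (R + x))"
    unfolding bounded_solution_def
  proof (intro conjI allI impI)
    show "continuous_on {0..} (\<lambda>x. - deriv \<theta> (R + x))"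
      by (intro continuous_intros continuous_on_compose2[OF cont(2)[of UNIV]]) auto
    fix x :: real
    have d\<theta>R: "((\<lambda>x. \<theta> (R + x)) has_real_derivative deriv \<theta> (R + x)) (at x within T)" for T
      using d\<theta> by (intro DERIV_at_within_shift_lemma[unfolded o_def]) (rule has_field_derivative_at_within)
    show "((\<lambda>x. \<theta>p - \<theta> (R + x)) has_real_derivative - deriv \<theta> (R + x)) (at x within {0..})"
      by (rule derivative_eq_intros d\<theta>R refl | simp)+
    show "((\<lambda>x. - deriv \<theta> (R + x)) has_real_derivative
        c * - deriv \<theta> (R + x) + G (\<theta>p - \<theta> (R + x))) (at x)" if "0 < x"
    proof -
      have "(deriv \<theta> has_real_derivative c * deriv \<theta> (R + x) - F q h (\<theta> (R + x))) (at (R + x))"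
        using classical_solution_onD[OF pde(3)] that by simp
      then have "((\<lambda>x. deriv \<theta> (R + x)) has_real_derivative c * deriv \<theta> (R + x) - F q h (\<theta> (R + x))) (at x)"
        by (intro DERIV_at_within_shift_lemma[unfolded o_def]) (rule has_field_derivative_at_within)
      from DERIV_minus[OF this] show ?thesis by (simp add: algebra_simps)
    qed
    assume "0 \<le> x"
    then have "\<theta>hl \<le> \<theta> (R + x) \<and> \<theta> (R + x) \<le> \<theta>p"
      using bound[rule_format, of "R + x"] S(5) hl by (cases "x = 0") auto
    then show "0 \<le> \<theta>p - \<theta> (R + x)" "\<theta>p - \<theta> (R + x) \<le> \<theta>p - \<theta>hl" by auto
  qed
qed

lemma slope_right_of_front:
  assumes C1: "\<theta> C1_differentiable_on UNIV"
    and sys: "free_interface_system q h \<theta>ig \<theta>hl R c \<theta>" and x: "R \<le> x"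
  shows "0 < deriv \<theta> x"
proof -
  note P = system_pieces[OF C1 sys]
  have "0 < c" "\<theta> R = \<theta>hl" using sys by (auto simp: free_interface_system_def)
  then have "- deriv \<theta> (R + (x - R)) < 0"
    using bounded_solution_decreasing[OF P(5) _ bounded_solution_pos[OF P(5)], of "x - R"] x hl by simp
  then show ?thesis by simp
qed

text \<open>
  Right of the front the slope is positive because the deficit decreases; from the front
  this propagates leftwards through the middle zone by the explicit form of the slope.
\<close>

lemma system_slope_pos:
  assumes C1: "\<theta> C1_differentiable_on UNIV"
    and sys: "free_interface_system q h \<theta>ig \<theta>hl R c \<theta>"
  shows "0 < deriv \<theta> x"
proof -
  note P = system_pieces[OF C1 sys]
  have S: "0 < R" "0 < c" "\<theta> R = \<theta>hl" using sys by (auto simp: free_interface_system_def)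
  have R: "0 < deriv \<theta> R" by (rule slope_right_of_front[OF C1 sys order_refl])
  have middle: "0 < deriv \<theta> x" if "0 \<le> x" "x \<le> R" for x
  proof -
    have "0 < c * ignited_profile q \<theta>ig c R - q * R" using R P(3)[of R] P(4)[of R] S by simp
    then have "0 < c * ignited_profile q \<theta>ig c x - q * x"
      by (rule ignited_slope_pos[OF S(2) q that(2)])
    then show ?thesis using P(3)[OF that] P(4)[OF that] by simp
  qed
  consider "x < 0" | "0 \<le> x" "x \<le> R" | "R \<le> x" by linarith
  then show ?thesis
  proof cases
    case 1
    have "(\<theta> has_real_derivative \<theta>ig * (exp (c * x) * c)) (at x)"
    proof (rule has_field_derivative_transform_within_open[of "\<lambda>x. \<theta>ig * exp (c * x)"])
      show "((\<lambda>x. \<theta>ig * exp (c * x)) has_real_derivative \<theta>ig * (exp (c * x) * c)) (at x)"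
        by (rule derivative_eq_intros refl | simp)+
      show "open {..<0::real}" by simp
    qed (use 1 P(2) in auto)
    then have "deriv \<theta> x = \<theta>ig * (exp (c * x) * c)" by (rule DERIV_imp_deriv)
    then show ?thesis using ig S by simp
  qed (use middle slope_right_of_front[OF C1 sys] in auto)
qed

lemma system_strict_mono:
  assumes "\<theta> C1_differentiable_on UNIV" and "free_interface_system q h \<theta>ig \<theta>hl R c \<theta>"
  shows "strict_mono \<theta>"
proof (rule strict_monoI)
  fix x y :: real assume "x < y"
  then show "\<theta> x < \<theta> y"
  proof (rule DERIV_pos_imp_increasing)
    fix t
    show "\<exists>y. (\<theta> has_real_derivative y) (at t) \<and> 0 < y"
      using system_pieces(1)[OF assms, of t] system_slope_pos[OF assms, of t] by blast
  qed
qed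

lemma lambda_minus_root:
  fixes c :: real
  defines "g \<equiv> 4 * h * (1 + \<theta>p) ^ 3"
  shows "lambda_minus q h c < 0" and "(lambda_minus q h c)\<^sup>2 = c * lambda_minus q h c + g"
proof -
  have g: "0 < g" using h ig ig_hl hl by (simp add: g_def)
  have L: "lambda_minus q h c = (c - sqrt (c\<^sup>2 + 4 * g)) / 2"
    by (simp add: lambda_minus_def deriv_F g_def)
  have "\<bar>c\<bar> < sqrt (c\<^sup>2 + 4 * g)" using g by (intro real_less_rsqrt) simp
  then show "lambda_minus q h c < 0" unfolding L by simp
  have "(sqrt (c\<^sup>2 + 4 * g))\<^sup>2 = c\<^sup>2 + 4 * g" using g by simp
  then show "(lambda_minus q h c)\<^sup>2 = c * lambda_minus q h c + g"
    unfolding L by (simp add: power2_eq_square field_simps)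
qed

lemma system_exp_convergence:
  assumes C1: "\<theta> C1_differentiable_on UNIV"
    and sys: "free_interface_system q h \<theta>ig \<theta>hl R c \<theta>"
  shows "\<exists>K>0. \<forall>\<^sub>F x in at_top. \<theta>p - \<theta> x \<le> K * exp (lambda_minus q h c * x)"
proof -
  have A: "0 < 1 + \<theta>p" using ig ig_hl hl by simp
  have c: "0 \<le> c" using sys by (simp add: free_interface_system_def)
  have pos: "0 < 4 * h * (1 + \<theta>p) ^ 3" "0 < 6 * h * (1 + \<theta>p)\<^sup>2" using A h by auto
  obtain K where K: "0 < K"
    "\<forall>\<^sub>F x in at_top. \<theta>p - \<theta> (R + x) \<le> K * exp (lambda_minus q h c * x)"
    using bounded_solution_exp_decay[OF system_pieces(5)[OF C1 sys] c pos G_lower lambda_minus_root]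
    by blast
  then obtain X where X: "\<And>x. X \<le> x \<Longrightarrow> \<theta>p - \<theta> (R + x) \<le> K * exp (lambda_minus q h c * x)"
    by (auto simp: eventually_at_top_linorder)
  have "\<theta>p - \<theta> x \<le> K * exp (- lambda_minus q h c * R) * exp (lambda_minus q h c * x)" if "R + X \<le> x" for x
    using X[of "x - R"] that by (simp add: algebra_simps flip: exp_add)
  then have "\<forall>\<^sub>F x in at_top. \<theta>p - \<theta> x \<le> K * exp (- lambda_minus q h c * R) * exp (lambda_minus q h c * x)"
    using eventually_at_top_linorder by blast
  then show ?thesis using K(1) by (intro exI[of _ "K * exp (- lambda_minus q h c * R)"]) auto
qed

section \<open>Uniqueness\<close>

text \<open>
  A larger speed cannot make the profile steeper to the right of the front.  By the first integral
  \<open>\<theta>'(R) = c * \<theta>hl - q * R\<close> its front would then lie further to the right; but in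
  the middle zone a larger speed also makes the profile steeper, so the temperature \<open>\<theta>hl\<close> would be
  reached earlier.
\<close>

lemma system_speed_le:
  assumes C1: "\<theta>1 C1_differentiable_on UNIV" "\<theta>2 C1_differentiable_on UNIV"
    and sys: "free_interface_system q h \<theta>ig \<theta>hl R1 c1 \<theta>1" "free_interface_system q h \<theta>ig \<theta>hl R2 c2 \<theta>2"
  shows "c2 \<le> c1"
proof (rule ccontr)
  assume "\<not> c2 \<le> c1"
  then have c: "c1 < c2" by simp
  note P = system_pieces[OF C1(1) sys(1)] and Q = system_pieces[OF C1(2) sys(2)]
  have S: "0 < R1" "0 < c1" "\<theta>1 R1 = \<theta>hl" "\<theta>1 0 = \<theta>ig" and T: "0 < R2" "0 < c2" "\<theta>2 R2 = \<theta>hl" "\<theta>2 0 = \<theta>ig"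
    using sys by (auto simp: free_interface_system_def)
  have "- deriv \<theta>1 (R1 + 0) - (- deriv \<theta>2 (R2 + 0)) \<le> 0"
  proof (rule right_derivative_nonpos)
    show "((\<lambda>x. (\<theta>p - \<theta>1 (R1 + x)) - (\<theta>p - \<theta>2 (R2 + x))) has_real_derivative
        - deriv \<theta>1 (R1 + 0) - (- deriv \<theta>2 (R2 + 0))) (at 0 within {0..})"
      by (rule DERIV_diff) (rule bounded_solutionD(2)[OF P(5)] bounded_solutionD(2)[OF Q(5)], simp)+
    fix x :: real assume "0 \<le> x"
    moreover have "0 \<le> (c1 - c2) * - deriv \<theta>1 (R1 + y)" if "0 \<le> y" for y
      using c slope_right_of_front[OF C1(1) sys(1), of "R1 + y"] that
      by (intro mult_nonpos_nonpos) auto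
    ultimately show "(\<theta>p - \<theta>1 (R1 + x)) - (\<theta>p - \<theta>2 (R2 + x)) \<le> 0"
      using bounded_solution_comparison[OF P(5) Q(5), of x] S T by simp
  qed (simp add: S T)
  then have "deriv \<theta>2 R2 \<le> deriv \<theta>1 R1" by simp
  moreover have "deriv \<theta>1 R1 = c1 * \<theta>hl - q * R1" "deriv \<theta>2 R2 = c2 * \<theta>hl - q * R2"
    using P(3)[of R1] Q(3)[of R2] S T by auto
  moreover have "c1 * \<theta>hl < c2 * \<theta>hl" using c ig ig_hl by simp
  ultimately have "q * R1 < q * R2" by linarith
  then have R: "R1 < R2" using q by simp
  \<comment> \<open>The difference satisfies \<open>d' = c2 * d + (c2 - c1) * \<theta>1\<close> up to \<open>R1\<close> and starts from \<open>0\<close>.\<close>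
  define p where "p = (\<lambda>x. (\<theta>2 x - \<theta>1 x) * exp (- c2 * x))"
  have "p 0 < p R1"
  proof (rule DERIV_pos_imp_increasing_open[OF S(1)])
    have dp: "(p has_real_derivative (deriv \<theta>2 x - deriv \<theta>1 x - c2 * (\<theta>2 x - \<theta>1 x)) * exp (- c2 * x)) (at x)" for x
      unfolding p_def
      by (rule derivative_eq_intros P(1) Q(1) refl)+ (simp add: algebra_simps)
    then show "continuous_on {0..R1} p"
      by (auto intro!: continuous_at_imp_continuous_on DERIV_isCont)
    fix x assume x: "0 < x" "x < R1"
    have "deriv \<theta>2 x - deriv \<theta>1 x - c2 * (\<theta>2 x - \<theta>1 x) = (c2 - c1) * \<theta>1 x"
      using P(3)[of x] Q(3)[of x] x R by (simp add: algebra_simps)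
    moreover have "0 < \<theta>1 x"
      using strict_monoD[OF system_strict_mono[OF C1(1) sys(1)] x(1)] S(4) ig by simp
    ultimately show "\<exists>y. (p has_real_derivative y) (at x) \<and> 0 < y"
      using dp[of x] c by (intro exI conjI) (assumption, simp)
  qed
  then have "\<theta>1 R1 < \<theta>2 R1" by (simp add: p_def S T zero_less_mult_iff)
  then show False
    using strict_monoD[OF system_strict_mono[OF C1(2) sys(2)] R] S T by simp
qed

lemma system_unique:
  assumes C1: "\<theta>1 C1_differentiable_on UNIV" "\<theta>2 C1_differentiable_on UNIV"
    and sys: "free_interface_system q h \<theta>ig \<theta>hl R1 c1 \<theta>1" "free_interface_system q h \<theta>ig \<theta>hl R2 c2 \<theta>2"
  shows "R1 = R2 \<and> c1 = c2 \<and> \<theta>1 = \<theta>2"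
proof -
  have c: "c1 = c2"
    using system_speed_le[OF C1 sys] system_speed_le[OF C1(2,1) sys(2,1)] by simp
  note P = system_pieces[OF C1(1) sys(1)]
    and Q = system_pieces[OF C1(2) sys(2), folded c]
  have S: "0 < R1" "0 < c1" "\<theta>1 R1 = \<theta>hl" and T: "0 < R2" "\<theta>2 R2 = \<theta>hl"
    using sys by (auto simp: free_interface_system_def)
  note mono = strict_monoD[OF system_strict_mono[OF C1(1) sys(1)]] strict_monoD[OF system_strict_mono[OF C1(2) sys(2)]]
  have R: "R1 = R2"
  proof (rule ccontr)
    assume "R1 \<noteq> R2"
    then consider "R1 < R2" | "R2 < R1" by linarith
    then show False
    proof cases
      case 1
      then show False using P(4)[of R1] Q(4)[of R1] mono(2)[OF 1] S T by simp
    next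
      case 2
      then show False using P(4)[of R2] Q(4)[of R2] mono(1)[OF 2] S T by simp
    qed
  qed
  have "\<theta>1 x = \<theta>2 x" for x
  proof -
    consider "x \<le> 0" | "0 \<le> x" "x \<le> R1" | "R1 \<le> x" by linarith
    then show ?thesis
    proof cases
      case 3
      then show ?thesis
        using bounded_solution_unique[OF P(5) Q(5), of "x - R1"] S T R by simp
    qed (use P(2,4) Q(2,4) R in auto)
  qed
  then show ?thesis using c R by blast
qed

section \<open>Existence\<close>

lemma system_exists:
  "\<exists>R c \<theta>. 0 < R \<and> 0 < c \<and> \<theta> C1_differentiable_on UNIV \<and> free_interface_system q h \<theta>ig \<theta>hl R c \<theta>"
proof -
  obtain P where P: "continuous_on {0..} P" "\<And>c. 0 \<le> c \<Longrightarrow> 0 < P c"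
    "\<And>c. 0 \<le> c \<Longrightarrow> P c \<le> sqrt (4 * h * (1 + \<theta>p) ^ 3) * (\<theta>p - \<theta>hl)"
    "\<And>c. 0 \<le> c \<Longrightarrow> \<exists>w w'. bounded_solution c w w' \<and> w 0 = \<theta>p - \<theta>hl \<and> w' 0 = - P c"
    using ex_slope_function by blast
  obtain c R where cR: "0 < c" "0 < R" "ignited_profile q \<theta>ig c R = \<theta>hl" "P c = c * \<theta>hl - q * R"
    using ex_matching_speed[OF q ig ig_hl P(1-3)] by blast
  then obtain w w' where w: "bounded_solution c w w'" "w 0 = \<theta>p - \<theta>hl" "w' 0 = - P c"
    using P(4)[of c] by auto
  define f where "f = ignited_profile q \<theta>ig c"
  have Rf: "f R = \<theta>hl" "P c = c * f R - q * R" using cR by (auto simp: f_def)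
  have c0: "0 \<le> c" using cR by simp
  note W = bounded_solutionD[OF w(1)]
  have w_pos: "0 < w x" if "0 \<le> x" for x
    using bounded_solution_pos[OF w(1) c0 _ that] w(2) hl by simp
  have w_dec: "w' x < 0" if "0 \<le> x" for x
    using bounded_solution_decreasing[OF w(1) c0 w_pos that] .
  have df: "(f has_real_derivative c * f x - q * x) (at x within S)" for x S
    unfolding f_def using cR by (intro ignited_profile_deriv) simp
  have cont_f: "continuous_on S f" for S by (rule DERIV_continuous_on[OF df])
  define \<theta>r D\<^sub>r where "\<theta>r = (\<lambda>x. if x \<le> R then f x else \<theta>p - w (- R + x))"
    and "D\<^sub>r = (\<lambda>x. if x \<le> R then c * f x - q * x else - w' (- R + x))"
  define \<theta> D where "\<theta> = (\<lambda>x. if x \<le> 0 then \<theta>ig * exp (c * x) else \<theta>r x)"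
    and "D = (\<lambda>x. if x \<le> 0 then c * (\<theta>ig * exp (c * x)) else D\<^sub>r x)"
  have d\<theta>r: "(\<theta>r has_real_derivative D\<^sub>r x) (at x)" for x
    unfolding \<theta>r_def D\<^sub>r_def
  proof (rule glue_deriv[OF df])
    show "((\<lambda>x. \<theta>p - w (- R + x)) has_real_derivative - w' (- R + x)) (at x within {R..})" if "R \<le> x" for x
    proof -
      have "((\<lambda>x. w (- R + x)) has_real_derivative w' (- R + x)) (at x within {R..})"
      proof (rule DERIV_at_within_shift_lemma[unfolded o_def])
        have img: "(+) (- R) ` {R..} = {0..}" unfolding image_add_atLeast by simp
        show "(w has_real_derivative w' (- R + x)) (at (- R + x) within (+) (- R) ` {R..})"
          unfolding img by (rule W(2)) (use that in simp)
      qed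
      then show ?thesis by (auto intro!: derivative_eq_intros)
    qed
  qed (use Rf w in auto)
  have cont_Dr: "continuous_on UNIV D\<^sub>r"
    unfolding D\<^sub>r_def
  proof (rule glue_continuous)
    show "continuous_on {..R} (\<lambda>x. c * f x - q * x)" by (intro continuous_intros cont_f)
    show "continuous_on {R..} (\<lambda>x. - w' (- R + x))"
      by (intro continuous_intros continuous_on_compose2[OF W(1)]) auto
  qed (use Rf w in simp)
  have at0: "\<theta>r 0 = \<theta>ig" "D\<^sub>r 0 = c * \<theta>ig" using cR by (auto simp: \<theta>r_def D\<^sub>r_def f_def)
  have d\<theta>: "(\<theta> has_real_derivative D x) (at x)" for x
    unfolding \<theta>_def D_def
  proof (rule glue_deriv)
    show "((\<lambda>x. \<theta>ig * exp (c * x)) has_real_derivative c * (\<theta>ig * exp (c * x))) (at x within {..0})" for x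
      by (rule derivative_eq_intros refl | simp)+
    show "(\<theta>r has_real_derivative D\<^sub>r x) (at x within {0..})" for x
      by (rule has_field_derivative_at_within[OF d\<theta>r])
  qed (use at0 in auto)
  have cont_D: "continuous_on UNIV D"
    unfolding D_def
  proof (rule glue_continuous)
    show "continuous_on {..0} (\<lambda>x. c * (\<theta>ig * exp (c * x)))" by (intro continuous_intros)
    show "continuous_on {0..} D\<^sub>r" using cont_Dr by (rule continuous_on_subset) simp
  qed (use at0 in simp)
  have C1: "\<theta> C1_differentiable_on UNIV"
    using d\<theta> cont_D by (auto simp: C1_differentiable_on_def has_real_derivative_iff_has_vector_derivative)
  have D_pos: "0 < D x" for x
  proof -
    have "0 < c * f x - q * x" if "x \<le> R" for x
      using ignited_slope_pos[OF cR(1) q that, of \<theta>ig] P(2)[OF c0] Rf by (simp add: f_def)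
    then show ?thesis using w_dec[of "- R + x"] cR ig by (auto simp: D_def D\<^sub>r_def)
  qed
  have mono: "\<theta> x < \<theta> y" if "x < y" for x y
    using that
  proof (rule DERIV_pos_imp_increasing)
    show "\<exists>y. (\<theta> has_real_derivative y) (at t) \<and> 0 < y" for t
      using d\<theta>[of t] D_pos[of t] by blast
  qed
  have vals: "\<theta> 0 = \<theta>ig" "\<theta> R = \<theta>hl" using cR Rf by (auto simp: \<theta>_def \<theta>r_def)
  have deriv_eq: "deriv \<theta> = D" using d\<theta> by (auto intro: DERIV_imp_deriv)
  have outer: "\<theta> x = \<theta>p - w (- R + x)" "D x = - w' (- R + x)" if "R < x" for x
    using that cR by (auto simp: \<theta>_def \<theta>r_def D_def D\<^sub>r_def)
  have "free_interface_system q h \<theta>ig \<theta>hl R c \<theta>"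
    unfolding free_interface_system_def
  proof (intro conjI)
    show "classical_solution_on {..<0} c (\<lambda>_. 0) \<theta>"
    proof (rule classical_solution_onI[OF d\<theta>])
      fix x :: real assume x: "x \<in> {..<0}"
      show "(D has_real_derivative c * D x - 0) (at x)"
      proof (rule has_field_derivative_transform_within_open[of "\<lambda>x. c * (\<theta>ig * exp (c * x))"])
        show "((\<lambda>x. c * (\<theta>ig * exp (c * x))) has_real_derivative c * D x - 0) (at x)"
          by (rule derivative_eq_intros refl | use x in \<open>simp add: D_def\<close>)+
        show "open {..<0::real}" by simp
      qed (use x in \<open>auto simp: D_def\<close>)
    qed
    show "classical_solution_on {0<..<R} c (\<lambda>_. q) \<theta>"
    proof (rule classical_solution_onI[OF d\<theta>])
      fix x :: real assume x: "x \<in> {0<..<R}"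
      show "(D has_real_derivative c * D x - q) (at x)"
      proof (rule has_field_derivative_transform_within_open[of "\<lambda>x. c * f x - q * x"])
        show "((\<lambda>x. c * f x - q * x) has_real_derivative c * D x - q) (at x)"
          by (rule derivative_eq_intros df refl | use x in \<open>simp add: D_def D\<^sub>r_def\<close>)+
        show "open {0<..<R}" by simp
      qed (use x in \<open>auto simp: D_def D\<^sub>r_def\<close>)
    qed
    show "classical_solution_on {R<..} c (F q h) \<theta>"
    proof (rule classical_solution_onI[OF d\<theta>])
      fix x :: real assume x: "x \<in> {R<..}"
      have "((\<lambda>x. w' (- R + x)) has_real_derivative c * w' (- R + x) + G (w (- R + x))) (at x)"
        by (rule DERIV_at_within_shift_lemma[unfolded o_def]) (use W(3)[of "- R + x"] x in simp)
      from DERIV_minus[OF this]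
      have "((\<lambda>x. - w' (- R + x)) has_real_derivative c * D x - F q h (\<theta> x)) (at x)"
        using x by (simp add: outer)
      then show "(D has_real_derivative c * D x - F q h (\<theta> x)) (at x)"
        by (rule has_field_derivative_transform_within_open[of _ _ _ "{R<..}"]) (use x outer in auto)
    qed
    show "\<forall>x\<in>{..<0}. 0 < \<theta> x \<and> \<theta> x < \<theta>ig" using mono[of _ 0] vals ig by (auto simp: \<theta>_def)
    show "\<forall>x\<in>{0<..<R}. \<theta>ig < \<theta> x \<and> \<theta> x < \<theta>hl" using mono[of 0] mono[of _ R] vals by auto
    show "\<forall>x\<in>{R<..}. \<theta>hl < \<theta> x \<and> \<theta> x < \<theta>p" using mono[of R] vals outer w_pos by auto
    show "(\<theta> \<longlongrightarrow> 0) at_bot"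
    proof (rule Lim_transform_eventually)
      have "filterlim (\<lambda>x. c * x) at_bot at_bot"
        by (rule filterlim_tendsto_pos_mult_at_bot[OF tendsto_const cR(1) filterlim_ident])
      then have "((\<lambda>x. exp (c * x)) \<longlongrightarrow> 0) at_bot" by (rule filterlim_compose[OF exp_at_bot])
      then show "((\<lambda>x. \<theta>ig * exp (c * x)) \<longlongrightarrow> 0) at_bot" by (rule tendsto_mult_right_zero)
      show "\<forall>\<^sub>F x in at_bot. \<theta>ig * exp (c * x) = \<theta> x"
        using eventually_le_at_bot[of 0] by (rule eventually_mono) (simp add: \<theta>_def)
    qed
    show "(\<theta> \<longlongrightarrow> \<theta>p) at_top"
    proof (rule Lim_transform_eventually)
      have "filterlim (\<lambda>x. - R + x) at_top at_top"
        by (rule filterlim_tendsto_add_at_top[OF tendsto_const filterlim_ident])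
      then have "((\<lambda>x. w (- R + x)) \<longlongrightarrow> 0) at_top"
        by (rule filterlim_compose[OF bounded_solution_tendsto_0[OF w(1) c0]])
      then show "((\<lambda>x. \<theta>p - w (- R + x)) \<longlongrightarrow> \<theta>p) at_top"
        by (auto intro!: tendsto_eq_intros)
      show "\<forall>\<^sub>F x in at_top. \<theta>p - w (- R + x) = \<theta> x"
        using eventually_gt_at_top[of R] by (rule eventually_mono) (simp add: outer)
    qed
    show "no_jump_at (deriv \<theta>) 0" "no_jump_at (deriv \<theta>) R"
      unfolding deriv_eq by (rule no_jump_at_of_continuous[OF cont_D])+
  qed (use cR vals in auto)
  then show ?thesis using cR C1 by blast
qed

end

theorem theorem2p1:
  fixes q h \<theta>ig \<theta>hl :: real
  assumes "q > 0" and "h > 0"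
    and "0 < \<theta>ig" and "\<theta>ig < \<theta>hl" and "\<theta>hl < theta_plus q h"
  shows "(\<exists>!T :: real \<times> real \<times> (real \<Rightarrow> real). case T of (R, c, \<theta>) \<Rightarrow>
            R > 0 \<and> c > 0 \<and> \<theta> C1_differentiable_on UNIV \<and>
            free_interface_system q h \<theta>ig \<theta>hl R c \<theta>) \<and>
         (\<forall>R c \<theta>.
            R > 0 \<and> c > 0 \<and> \<theta> C1_differentiable_on UNIV \<and>
            free_interface_system q h \<theta>ig \<theta>hl R c \<theta> \<longrightarrow>
            strict_mono \<theta> \<and> lambda_minus q h c < 0 \<and>
            (\<exists>K\<^sub>0>0. \<forall>\<^sub>F x in at_top.
               theta_plus q h - \<theta> x \<le> K\<^sub>0 * exp (lambda_minus q h c * x)))"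
proof -
  interpret flame q h \<theta>ig \<theta>hl by unfold_locales (use assms in auto)
  show ?thesis
  proof (intro conjI allI impI)
    obtain R c \<theta> where "0 < R" "0 < c" "\<theta> C1_differentiable_on UNIV"
      "free_interface_system q h \<theta>ig \<theta>hl R c \<theta>"
      using system_exists by blast
    then show "\<exists>!T. case T of (R, c, \<theta>) \<Rightarrow> R > 0 \<and> c > 0 \<and> \<theta> C1_differentiable_on UNIV \<and>
        free_interface_system q h \<theta>ig \<theta>hl R c \<theta>"
      using system_unique by (intro ex1I[of _ "(R, c, \<theta>)"]) auto
  qed (use system_strict_mono lambda_minus_root(1) system_exp_convergence in auto)
qed

end
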